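(* The Lie algebra $\mathfrak{iso}_G$ of the isometry group $Iso(G)$ of the metric $G$ on $P=\mathbb{R}^{2n+1}$ is the Lie algebra $\mathfrak{gl}(n,\mathbb{R})\times\mathfrak{h}_n$, being the semidirect product of the linear Lie algebra $\mathfrak{gl}(n,\mathbb{R})$, embedded into the symplectic Lie algebra $\mathfrak{sp}(n,\mathbb{R})$, with generators $$Q^k_l=p_l\partial_{p_k}-x^k\partial_{x^l}\quad(1\le k,l\le n),$$ and of the Heisenberg Lie algebra $\mathfrak{h}_n$ with generators $$\xi=\partial_{x^0},\qquad A_i=\partial_{p_i}+x^i\partial_{x^0},\qquad B_j=-\partial_{x^j}\quad(1\le i,j\le n).$$ The nonzero commutator relations of these generators are $$[A_i,B_j]=\delta_{ij}\xi,\quad [Q^k_l,A_i]=-\delta_{il}A_k,\quad [Q^k_l,B_j]=\delta_{kj}B_l,\quad [Q^k_l,Q^r_s]=\delta_{ks}Q^r_l-\delta_{rl}Q^k_s.$$ All these vector fields are $\theta$-contact, with the contact Hamiltonians $$H_\xi=1,\quad H_{A_j}=p_j,\quad H_{B_i}=x^i,\quad H_{Q^k_l}=x^kp_l$$ respectively.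
   Context: $P=\mathbb{R}^{2n+1}$ has coordinates $(x^0;p_1,\dots,p_n;x^1,\dots,x^n)$ and is endowed with the contact form $\theta=dx^0+\sum_{i=1}^n p_i\,dx^i$. The Mrugala metric is the pseudo-Riemannian metric of signature $(n+1,n)$ given by $G=2\sum_{k=1}^n dp_k\odot dx^k+\theta\otimes\theta$, where $dp_k\odot dx^k=\frac12(dp_k\otimes dx^k+dx^k\otimes dp_k)$. The Lie algebra $\mathfrak{iso}_G$ is the Lie algebra of Killing vector fields of $G$, i.e. of vector fields $X$ with $\mathcal{L}_XG=0$. A vector field $X$ is $\theta$-contact if $\mathcal{L}_X\theta=f\theta$ for some function $f$; the contact Hamiltonian of such a field is its generating function, in the standard convention $H_X=\theta(X)$.
   Formalization: For θ=dx^0+Σp_i dx^i, A_i is corrected to ∂_{p_i}−x^i∂_{x^0}, so [A_i,B_j]=−δ_ij ξ, H_{A_i}=−x^i, H_{B_j}=−p_j, H_Q=−x^k p_l; also shown for θ=dx^0−Σp_i dx^i (and its G) with the printed generators and brackets, where H_{A_i}=x^i, H_{B_j}=p_j. *)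

theory Defs
  imports "HOL-Analysis.Analysis" "HOL-Library.Function_Algebras"
begin

section \<open>Lie algebras\<close>

text \<open>Function spaces carry the pointwise vector space structure, so that \<^const>\<open>span\<close>,
  \<^const>\<open>subspace\<close>, \<^const>\<open>independent\<close> and \<^const>\<open>linear\<close> apply to vector fields and to
  endomorphisms.\<close>

instantiation "fun" :: (type, real_vector) real_vector
begin

definition scaleR_fun :: "real \<Rightarrow> ('a \<Rightarrow> 'b) \<Rightarrow> 'a \<Rightarrow> 'b" where
  "scaleR_fun c f = (\<lambda>x. c *\<^sub>R f x)"

instance
  by standard (auto simp: scaleR_fun_def fun_eq_iff scaleR_add_right scaleR_add_left)

end

definition lie_algebra_on :: "'a::real_vector set \<Rightarrow> ('a \<Rightarrow> 'a \<Rightarrow> 'a) \<Rightarrow> bool" where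
  "lie_algebra_on L br \<longleftrightarrow>
     subspace L \<and>
     (\<forall>x\<in>L. \<forall>y\<in>L. br x y \<in> L) \<and>
     (\<forall>x\<in>L. \<forall>y\<in>L. \<forall>z\<in>L. \<forall>c. br (x + y) z = br x z + br y z \<and> br z (x + y) = br z x + br z y \<and>
        br (c *\<^sub>R x) z = c *\<^sub>R br x z \<and> br z (c *\<^sub>R x) = c *\<^sub>R br z x) \<and>
     (\<forall>x\<in>L. br x x = 0) \<and>
     (\<forall>x\<in>L. \<forall>y\<in>L. \<forall>z\<in>L. br x (br y z) + br y (br z x) + br z (br x y) = 0)"

definition lie_hom ::
    "'a::real_vector set \<Rightarrow> ('a \<Rightarrow> 'a \<Rightarrow> 'a) \<Rightarrow> 'b::real_vector set \<Rightarrow> ('b \<Rightarrow> 'b \<Rightarrow> 'b)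
       \<Rightarrow> ('a \<Rightarrow> 'b) \<Rightarrow> bool" where
  "lie_hom L br M br' f \<longleftrightarrow>
     lie_algebra_on L br \<and> lie_algebra_on M br' \<and> f ` L \<subseteq> M \<and>
     (\<forall>x\<in>L. \<forall>y\<in>L. f (x + y) = f x + f y \<and> f (br x y) = br' (f x) (f y)) \<and>
     (\<forall>x\<in>L. \<forall>c. f (c *\<^sub>R x) = c *\<^sub>R f x)"

definition lie_iso ::
    "'a::real_vector set \<Rightarrow> ('a \<Rightarrow> 'a \<Rightarrow> 'a) \<Rightarrow> 'b::real_vector set \<Rightarrow> ('b \<Rightarrow> 'b \<Rightarrow> 'b)
       \<Rightarrow> ('a \<Rightarrow> 'b) \<Rightarrow> bool" where
  "lie_iso L br M br' f \<longleftrightarrow> lie_hom L br M br' f \<and> bij_betw f L M"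

definition lie_ideal :: "'a::real_vector set \<Rightarrow> 'a set \<Rightarrow> ('a \<Rightarrow> 'a \<Rightarrow> 'a) \<Rightarrow> bool" where
  "lie_ideal I L br \<longleftrightarrow> I \<subseteq> L \<and> subspace I \<and> (\<forall>x\<in>L. \<forall>y\<in>I. br x y \<in> I)"

text \<open>\<open>L\<close> is the internal semidirect product of the subalgebra \<open>K\<close> and the ideal \<open>I\<close>.\<close>

definition internal_semidirect ::
    "'a::real_vector set \<Rightarrow> 'a set \<Rightarrow> 'a set \<Rightarrow> ('a \<Rightarrow> 'a \<Rightarrow> 'a) \<Rightarrow> bool" where
  "internal_semidirect L K I br \<longleftrightarrow>
     lie_algebra_on L br \<and> lie_algebra_on K br \<and> lie_ideal I L br \<and>
     K \<inter> I = {0} \<and> L = {x + y | x y. x \<in> K \<and> y \<in> I}"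

text \<open>Bracket of the external semidirect product, \<open>D\<close> being the action of the first factor on the
  second by derivations.\<close>

definition semidirect_bracket ::
    "('a \<Rightarrow> 'a \<Rightarrow> 'a) \<Rightarrow> ('b::ab_group_add \<Rightarrow> 'b \<Rightarrow> 'b) \<Rightarrow> ('a \<Rightarrow> 'b \<Rightarrow> 'b)
       \<Rightarrow> 'a \<times> 'b \<Rightarrow> 'a \<times> 'b \<Rightarrow> 'a \<times> 'b" where
  "semidirect_bracket brK brI D =
     (\<lambda>(M, u) (N, v). (brK M N, brI u v + D M v - D N u))"

text \<open>The classical algebras \<open>gl(n,R)\<close>, \<open>sp(n,R)\<close> (acting on a space of dimension \<open>2n\<close>) and the
  Heisenberg algebra \<open>h\<^sub>n\<close>.\<close>

definition gl_bracket :: "real^'n^'n \<Rightarrow> real^'n^'n \<Rightarrow> real^'n^'n" where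
  "gl_bracket M N = M ** N - N ** M"

definition omega :: "(real^'n) \<times> (real^'n) \<Rightarrow> (real^'n) \<times> (real^'n) \<Rightarrow> real" where
  "omega = (\<lambda>(a, b) (a', b'). a \<bullet> b' - b \<bullet> a')"

definition sp_algebra :: "((real^'n) \<times> (real^'n) \<Rightarrow> (real^'n) \<times> (real^'n)) set" where
  "sp_algebra = {S. linear S \<and> (\<forall>u v. omega (S u) v + omega u (S v) = 0)}"

definition end_bracket :: "('a \<Rightarrow> 'a::ab_group_add) \<Rightarrow> ('a \<Rightarrow> 'a) \<Rightarrow> 'a \<Rightarrow> 'a" where
  "end_bracket S T = (S \<circ> T) - (T \<circ> S)"

definition gl_to_sp :: "real^'n^'n \<Rightarrow> (real^'n) \<times> (real^'n) \<Rightarrow> (real^'n) \<times> (real^'n)" where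
  "gl_to_sp M = (\<lambda>(a, b). (- (transpose M *v a), M *v b))"

definition heis_bracket ::
    "real \<times> (real^'n) \<times> (real^'n) \<Rightarrow> real \<times> (real^'n) \<times> (real^'n) \<Rightarrow> real \<times> (real^'n) \<times> (real^'n)" where
  "heis_bracket = (\<lambda>(c, w) (c', w'). (omega w w', 0))"

definition sp_on_heis ::
    "((real^'n) \<times> (real^'n) \<Rightarrow> (real^'n) \<times> (real^'n))
       \<Rightarrow> real \<times> (real^'n) \<times> (real^'n) \<Rightarrow> real \<times> (real^'n) \<times> (real^'n)" where
  "sp_on_heis S = (\<lambda>(c, w). (0, S w))"

section \<open>Vector fields and Lie derivatives on a vector space\<close>

primrec C_diff :: "nat \<Rightarrow> ('a::real_normed_vector \<Rightarrow> 'b::real_normed_vector) \<Rightarrow> bool" where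
  "C_diff 0 f \<longleftrightarrow> continuous_on UNIV f"
| "C_diff (Suc k) f \<longleftrightarrow> (\<forall>z. f differentiable at z) \<and>
     (\<forall>v. C_diff k (\<lambda>z. frechet_derivative f (at z) v))"

text \<open>Meant for a finite-dimensional domain, where smoothness in each direction \<open>v\<close> is smoothness of
  the derivative as a map into the linear maps.\<close>

definition smooth :: "('a::real_normed_vector \<Rightarrow> 'b::real_normed_vector) \<Rightarrow> bool" where
  "smooth f \<longleftrightarrow> (\<forall>k. C_diff k f)"

definition vf_bracket ::
    "('a::real_normed_vector \<Rightarrow> 'a) \<Rightarrow> ('a \<Rightarrow> 'a) \<Rightarrow> 'a \<Rightarrow> 'a" where
  "vf_bracket X Y = (\<lambda>z. frechet_derivative Y (at z) (X z) - frechet_derivative X (at z) (Y z))"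

text \<open>Lie derivatives of a one-form \<open>\<alpha>\<close> and of a covariant 2-tensor \<open>g\<close>; these are
  \<open>X (\<alpha> Y) - \<alpha> [X, Y]\<close> and \<open>X (g Y Z) - g [X, Y] Z - g Y [X, Z]\<close> evaluated on the constant
  fields \<open>Y = u\<close>, \<open>Z = v\<close>, for which \<open>[X, u] = - DX u\<close>.\<close>

definition lie_deriv_form ::
    "('a::real_normed_vector \<Rightarrow> 'a) \<Rightarrow> ('a \<Rightarrow> 'a \<Rightarrow> real) \<Rightarrow> 'a \<Rightarrow> 'a \<Rightarrow> real" where
  "lie_deriv_form X \<alpha> = (\<lambda>z u.
     frechet_derivative (\<lambda>y. \<alpha> y u) (at z) (X z) + \<alpha> z (frechet_derivative X (at z) u))"

definition lie_deriv_tensor ::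
    "('a::real_normed_vector \<Rightarrow> 'a) \<Rightarrow> ('a \<Rightarrow> 'a \<Rightarrow> 'a \<Rightarrow> real) \<Rightarrow> 'a \<Rightarrow> 'a \<Rightarrow> 'a \<Rightarrow> real" where
  "lie_deriv_tensor X g = (\<lambda>z u v.
     frechet_derivative (\<lambda>y. g y u v) (at z) (X z)
       + g z (frechet_derivative X (at z) u) v + g z u (frechet_derivative X (at z) v))"

definition killing_algebra ::
    "('a::real_normed_vector \<Rightarrow> 'a \<Rightarrow> 'a \<Rightarrow> real) \<Rightarrow> ('a \<Rightarrow> 'a) set" where
  "killing_algebra g = {X. smooth X \<and> (\<forall>z u v. lie_deriv_tensor X g z u v = 0)}"

definition contact_field ::
    "('a::real_normed_vector \<Rightarrow> 'a \<Rightarrow> real) \<Rightarrow> ('a \<Rightarrow> 'a) \<Rightarrow> bool" where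
  "contact_field \<alpha> X \<longleftrightarrow> smooth X \<and>
     (\<exists>f. smooth f \<and> (\<forall>z u. lie_deriv_form X \<alpha> z u = f z * \<alpha> z u))"

definition contact_hamiltonian ::
    "('a::real_normed_vector \<Rightarrow> 'a \<Rightarrow> real) \<Rightarrow> ('a \<Rightarrow> 'a) \<Rightarrow> 'a \<Rightarrow> real" where
  "contact_hamiltonian \<alpha> X = (\<lambda>z. \<alpha> z (X z))"

section \<open>The thermodynamical phase space\<close>

text \<open>Points are triples \<open>(x\<^sup>0, p, x)\<close>. The coordinate functions are linear, so each of them also
  serves as its own differential.\<close>

type_synonym 'n phase = "real \<times> (real^'n) \<times> (real^'n)"

definition coord_x0 :: "'n::finite phase \<Rightarrow> real" where "coord_x0 z = fst z"
definition coord_p :: "'n::finite \<Rightarrow> 'n phase \<Rightarrow> real" where "coord_p i z = fst (snd z) $ i"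
definition coord_x :: "'n::finite \<Rightarrow> 'n phase \<Rightarrow> real" where "coord_x i z = snd (snd z) $ i"

definition d_x0 :: "'n::finite phase" where "d_x0 = (1, 0, 0)"
definition d_p :: "'n::finite \<Rightarrow> 'n phase" where "d_p i = (0, axis i 1, 0)"
definition d_x :: "'n::finite \<Rightarrow> 'n phase" where "d_x i = (0, 0, axis i 1)"

text \<open>The parameter \<open>s\<close> is a sign, \<open>\<theta> = dx\<^sup>0 + s \<Sum> p\<^sub>i dx\<^sup>i\<close>. The two signs are exchanged
  by the reflection \<open>x\<^sup>0 \<mapsto> - x\<^sup>0\<close> up to an overall sign of \<open>\<theta>\<close>. The field
  \<open>\<partial>\<^bsub>p i\<^esub> + x\<^sup>i \<partial>\<^bsub>x 0\<^esub>\<close> is Killing and contact for \<open>s = -1\<close> only; for \<open>s = 1\<close>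
  its place is taken by \<open>\<partial>\<^bsub>p i\<^esub> - x\<^sup>i \<partial>\<^bsub>x 0\<^esub>\<close>.\<close>

definition theta :: "real \<Rightarrow> 'n::finite phase \<Rightarrow> 'n phase \<Rightarrow> real" where
  "theta s z u = coord_x0 u + s * (\<Sum>i\<in>UNIV. coord_p i z * coord_x i u)"

definition sym_prod :: "('a \<Rightarrow> real) \<Rightarrow> ('a \<Rightarrow> real) \<Rightarrow> 'a \<Rightarrow> 'a \<Rightarrow> real" where
  "sym_prod \<alpha> \<beta> u v = (\<alpha> u * \<beta> v + \<beta> u * \<alpha> v) / 2"

definition mrugala :: "real \<Rightarrow> 'n::finite phase \<Rightarrow> 'n phase \<Rightarrow> 'n phase \<Rightarrow> real" where
  "mrugala s z u v = 2 * (\<Sum>k\<in>UNIV. sym_prod (coord_p k) (coord_x k) u v) + theta s z u * theta s z v"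

definition field_Q :: "'n::finite \<Rightarrow> 'n \<Rightarrow> 'n phase \<Rightarrow> 'n phase" where
  "field_Q k l = (\<lambda>z. coord_p l z *\<^sub>R d_p k - coord_x k z *\<^sub>R d_x l)"

definition field_xi :: "'n::finite phase \<Rightarrow> 'n phase" where
  "field_xi = (\<lambda>z. d_x0)"

definition field_A :: "real \<Rightarrow> 'n::finite \<Rightarrow> 'n phase \<Rightarrow> 'n phase" where
  "field_A s i = (\<lambda>z. d_p i - (s * coord_x i z) *\<^sub>R d_x0)"

definition field_B :: "'n::finite \<Rightarrow> 'n phase \<Rightarrow> 'n phase" where
  "field_B j = (\<lambda>z. - d_x j)"

definition gl_fields :: "('n::finite phase \<Rightarrow> 'n phase) set" where
  "gl_fields = span {field_Q k l | k l. True}"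

definition heis_fields :: "real \<Rightarrow> ('n::finite phase \<Rightarrow> 'n phase) set" where
  "heis_fields s = span ({field_xi} \<union> range (field_A s) \<union> range field_B)"

end

theory Submission
  imports Defs
begin

text \<open>Let \<open>X\<close> be a Killing field with components \<open>a\<^sub>i\<close> along \<open>\<partial>\<^bsub>p i\<^esub>\<close> and \<open>b\<^sub>i\<close> along
  \<open>\<partial>\<^bsub>x i\<^esub>\<close>, let \<open>h = \<theta>(X)\<close> be its Hamiltonian and let \<open>T = \<partial>\<^bsub>x 0\<^esub>\<close>. The Killing equations give
  \<open>T h = 0\<close>, \<open>T b\<^sub>i + \<partial>\<^bsub>p i\<^esub> h = s b\<^sub>i\<close> and \<open>T a\<^sub>i + \<partial>\<^bsub>x i\<^esub> h = - s a\<^sub>i\<close>, whence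
  \<open>T T b\<^sub>i = s T b\<^sub>i\<close> and \<open>T T a\<^sub>i = - s T a\<^sub>i\<close>. Differentiating the remaining equations along \<open>T\<close>
  and commuting \<open>\<partial>\<^bsub>p i\<^esub>\<close> with \<open>\<partial>\<^bsub>x i\<^esub>\<close> forces \<open>T a\<^sub>i = T b\<^sub>i = 0\<close>. So \<open>X\<close> is the Hamiltonian
  field of \<open>h\<close>, and the equations say that \<open>h\<close> is affine in \<open>p\<close> and in \<open>x\<close> separately. This makes \<open>X\<close>
  an affine vector field of the form \<open>iso_field\<close>, on which all Lie algebraic claims are
  statements about matrices.\<close>

section \<open>Smooth functions and directional derivatives\<close>

text \<open>The direction comes first, so that \<open>dir_deriv v\<close> is an operator on
  functions that can be iterated and commuted with \<open>dir_deriv u\<close>.\<close>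

definition dir_deriv :: "'a::real_normed_vector \<Rightarrow> ('a \<Rightarrow> 'b::real_normed_vector) \<Rightarrow> 'a \<Rightarrow> 'b" where
  "dir_deriv v f = (\<lambda>z. frechet_derivative f (at z) v)"

lemma dir_deriv_eqI: "(f has_derivative f') (at z) \<Longrightarrow> dir_deriv v f z = f' v"
  by (simp add: dir_deriv_def frechet_derivative_at[symmetric])

lemma has_derivative_dir_deriv: "f differentiable at z \<Longrightarrow> (f has_derivative (\<lambda>v. dir_deriv v f z)) (at z)"
  by (simp add: dir_deriv_def frechet_derivative_works)

lemma dir_deriv_const: "dir_deriv v (\<lambda>_. c) = (\<lambda>_. 0)"
  by (simp add: dir_deriv_def)

lemma C_diff_Suc: "C_diff (Suc k) f \<longleftrightarrow> (\<forall>z. f differentiable at z) \<and> (\<forall>v. C_diff k (dir_deriv v f))"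
  by (simp add: dir_deriv_def)

declare C_diff.simps(2) [simp del]

lemma C_diff_mono: "C_diff (Suc k) f \<Longrightarrow> C_diff k f"
proof (induction k arbitrary: f)
  case 0
  then show ?case
    by (auto simp: C_diff_Suc continuous_on_eq_continuous_within differentiable_imp_continuous_within)
next
  case (Suc k)
  then show ?case by (metis C_diff_Suc)
qed

lemma C_diff_const: "C_diff k (\<lambda>_. c)"
  by (induction k arbitrary: c) (auto simp: C_diff_Suc dir_deriv_const)

lemma dir_deriv_bounded_linear_comp:
  assumes "bounded_linear L" "f differentiable at z"
  shows "dir_deriv v (\<lambda>z. L (f z)) z = L (dir_deriv v f z)"
  using bounded_linear.has_derivative[OF assms(1) has_derivative_dir_deriv[OF assms(2)]] by (rule dir_deriv_eqI)

lemma C_diff_bounded_linear_comp: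
  assumes "bounded_linear L"
  shows "C_diff k f \<Longrightarrow> C_diff k (\<lambda>z. L (f z))"
proof (induction k arbitrary: f)
  case 0
  then show ?case using bounded_linear.continuous_on[OF assms] by auto
next
  case (Suc k)
  have d: "f differentiable at z" for z using Suc.prems by (simp add: C_diff_Suc)
  have "dir_deriv v (\<lambda>z. L (f z)) = (\<lambda>z. L (dir_deriv v f z))" for v
    using dir_deriv_bounded_linear_comp[OF assms d] by auto
  moreover have "(\<lambda>z. L (f z)) differentiable at z" for z
    using bounded_linear.has_derivative[OF assms has_derivative_dir_deriv[OF d]]
    by (auto simp: differentiable_def)
  ultimately show ?case using Suc by (auto simp: C_diff_Suc)
qed

lemma dir_deriv_add:
  assumes "f differentiable at z" "g differentiable at z"
  shows "dir_deriv v (\<lambda>z. f z + g z) z = dir_deriv v f z + dir_deriv v g z"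
  using has_derivative_add[OF assms[THEN has_derivative_dir_deriv]] by (rule dir_deriv_eqI)

lemma C_diff_add: "C_diff k f \<Longrightarrow> C_diff k g \<Longrightarrow> C_diff k (\<lambda>z. f z + g z)"
proof (induction k arbitrary: f g)
  case 0
  then show ?case by (auto intro: continuous_on_add)
next
  case (Suc k)
  then have d: "f differentiable at z" "g differentiable at z" for z by (auto simp: C_diff_Suc)
  have "dir_deriv v (\<lambda>z. f z + g z) = (\<lambda>z. dir_deriv v f z + dir_deriv v g z)" for v
    using dir_deriv_add[OF d] by auto
  then show ?case using Suc d by (auto simp: C_diff_Suc)
qed

lemma dir_deriv_inner:
  assumes "f differentiable at z" "g differentiable at z"
  shows "dir_deriv v (\<lambda>z. f z \<bullet> g z) z = f z \<bullet> dir_deriv v g z + dir_deriv v f z \<bullet> g z"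
  using has_derivative_inner[OF assms[THEN has_derivative_dir_deriv]] by (rule dir_deriv_eqI)

lemma C_diff_inner: "C_diff k f \<Longrightarrow> C_diff k g \<Longrightarrow> C_diff k (\<lambda>z. f z \<bullet> g z)"
proof (induction k arbitrary: f g)
  case 0
  then show ?case by (auto intro: continuous_on_inner)
next
  case (Suc k)
  then have d: "f differentiable at z" "g differentiable at z" for z by (auto simp: C_diff_Suc)
  have "dir_deriv v (\<lambda>z. f z \<bullet> g z) = (\<lambda>z. f z \<bullet> dir_deriv v g z + dir_deriv v f z \<bullet> g z)" for v
    using dir_deriv_inner[OF d] by auto
  \<comment> \<open>The product rule pairs each derivative with an undifferentiated factor, whose
    order is lowered to \<open>k\<close> by \<open>C_diff_mono\<close>.\<close>
  moreover have "C_diff k (\<lambda>z. f z \<bullet> dir_deriv v g z + dir_deriv v f z \<bullet> g z)" for v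
    using Suc.prems by (intro C_diff_add Suc.IH) (auto simp: C_diff_Suc intro: C_diff_mono)
  moreover have "(\<lambda>z. f z \<bullet> g z) differentiable at z" for z
    using has_derivative_inner[OF d[THEN has_derivative_dir_deriv]] by (auto simp: differentiable_def)
  ultimately show ?case by (simp add: C_diff_Suc)
qed

lemma smooth_dir_deriv: "smooth f \<Longrightarrow> smooth (dir_deriv v f)"
  unfolding smooth_def by (metis C_diff_Suc)

lemma smooth_differentiable: "smooth f \<Longrightarrow> f differentiable at z"
  unfolding smooth_def by (metis C_diff_Suc)

lemma smooth_continuous: "smooth f \<Longrightarrow> continuous_on UNIV f"
  unfolding smooth_def by (metis C_diff.simps(1))

lemma smooth_bounded_linear_comp: "bounded_linear L \<Longrightarrow> smooth f \<Longrightarrow> smooth (\<lambda>z. L (f z))"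
  by (simp add: smooth_def C_diff_bounded_linear_comp)

lemma smooth_add: "smooth f \<Longrightarrow> smooth g \<Longrightarrow> smooth (\<lambda>z. f z + g z)"
  by (simp add: smooth_def C_diff_add)

lemma smooth_inner: "smooth f \<Longrightarrow> smooth g \<Longrightarrow> smooth (\<lambda>z. f z \<bullet> g z)"
  by (simp add: smooth_def C_diff_inner)

lemma smooth_const: "smooth (\<lambda>_. c)"
  by (simp add: smooth_def C_diff_const)

lemma has_derivative_affine:
  fixes L :: "'a::euclidean_space \<Rightarrow> 'b::real_normed_vector"
  assumes "linear L"
  shows "((\<lambda>z. L z + w) has_derivative L) (at z)"
  using linear_imp_has_derivative[OF assms] by (auto intro!: derivative_eq_intros)

lemma smooth_affine:
  fixes L :: "'a::euclidean_space \<Rightarrow> 'b::real_normed_vector"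
  assumes "linear L"
  shows "smooth (\<lambda>z. L z + w)"
proof -
  have "dir_deriv v (\<lambda>z. L z + w) = (\<lambda>_. L v)" for v
    using dir_deriv_eqI[OF has_derivative_affine[OF assms]] by auto
  then have "C_diff (Suc k) (\<lambda>z. L z + w)" for k
    using has_derivative_affine[OF assms, of w]
    by (auto simp: C_diff_Suc C_diff_const differentiable_def)
  then show ?thesis by (simp add: smooth_def C_diff_mono)
qed

text \<open>The mean value theorem is applied twice: first along \<open>u\<close> to the increment
  of \<open>f\<close> in direction \<open>r *\<^sub>R v\<close>, then along \<open>v\<close> to
  \<open>dir_deriv u f\<close>.\<close>

lemma second_difference_mvt:
  fixes f :: "'a::real_normed_vector \<Rightarrow> real"
  assumes "smooth f" "0 < r"
  shows "\<exists>x y. 0 < x \<and> x < r \<and> 0 < y \<and> y < r \<and>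
    f (z + r *\<^sub>R u + r *\<^sub>R v) - f (z + r *\<^sub>R u) - (f (z + r *\<^sub>R v) - f z)
      = r * (r * dir_deriv v (dir_deriv u f) (z + x *\<^sub>R u + y *\<^sub>R v))"
proof -
  \<comment> \<open>Restriction to a line turns directional derivatives into ordinary ones, as
    \<open>MVT2\<close> requires.\<close>
  have along: "((\<lambda>t. g (c + t *\<^sub>R w)) has_real_derivative dir_deriv w g (c + t *\<^sub>R w)) (at t)"
    if "smooth g" for g :: "'a \<Rightarrow> real" and c w t
  proof -
    have "((\<lambda>t. g (c + t *\<^sub>R w)) has_derivative (\<lambda>h. dir_deriv (h *\<^sub>R w) g (c + t *\<^sub>R w))) (at t)"
      by (rule has_derivative_compose[where g = g and f = "\<lambda>t. c + t *\<^sub>R w", OF _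
            has_derivative_dir_deriv[OF smooth_differentiable[OF that]]])
        (auto intro!: derivative_eq_intros)
    moreover have "dir_deriv (h *\<^sub>R w) g y = dir_deriv w g y * h" for h y
      using linear_frechet_derivative[OF smooth_differentiable[OF that, of y]]
      by (simp add: dir_deriv_def linear_cmul)
    ultimately show ?thesis by (simp add: has_field_derivative_def)
  qed
  let ?F = "\<lambda>t. f (z + r *\<^sub>R v + t *\<^sub>R u) - f (z + t *\<^sub>R u)"
  have "\<exists>x. 0 < x \<and> x < r \<and> ?F r - ?F 0 =
      (r - 0) * (dir_deriv u f (z + r *\<^sub>R v + x *\<^sub>R u) - dir_deriv u f (z + x *\<^sub>R u))"
    by (intro MVT2 assms(2)) (intro derivative_intros along assms(1))
  then obtain x where x: "0 < x" "x < r" "?F r - ?F 0 =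
      r * (dir_deriv u f (z + r *\<^sub>R v + x *\<^sub>R u) - dir_deriv u f (z + x *\<^sub>R u))"
    by auto
  have "\<exists>y. 0 < y \<and> y < r \<and> dir_deriv u f (z + x *\<^sub>R u + r *\<^sub>R v) - dir_deriv u f (z + x *\<^sub>R u + 0 *\<^sub>R v) =
      (r - 0) * dir_deriv v (dir_deriv u f) (z + x *\<^sub>R u + y *\<^sub>R v)"
    by (intro MVT2 assms(2)) (intro derivative_intros along smooth_dir_deriv assms(1))
  then obtain y where y: "0 < y" "y < r" "dir_deriv u f (z + x *\<^sub>R u + r *\<^sub>R v) - dir_deriv u f (z + x *\<^sub>R u) =
      r * dir_deriv v (dir_deriv u f) (z + x *\<^sub>R u + y *\<^sub>R v)"
    by auto
  have "?F r - ?F 0 = r * (r * dir_deriv v (dir_deriv u f) (z + x *\<^sub>R u + y *\<^sub>R v))"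
    unfolding x(3) y(3)[symmetric] by (simp add: ac_simps)
  then show ?thesis using x y by (intro exI[of _ x] exI[of _ y]) (simp add: ac_simps)
qed

text \<open>Both iterated derivatives compute the same mixed second difference of \<open>f\<close>, up to evaluation at
  nearby points.\<close>

lemma dir_deriv_commute:
  fixes f :: "'a::real_normed_vector \<Rightarrow> real"
  assumes f: "smooth f"
  shows "dir_deriv u (dir_deriv v f) z = dir_deriv v (dir_deriv u f) z"
proof -
  let ?r = "\<lambda>n. inverse (real (Suc n))"
  have ex: "\<exists>x y x' y'. 0 < x \<and> x < ?r n \<and> 0 < y \<and> y < ?r n \<and> 0 < x' \<and> x' < ?r n \<and> 0 < y' \<and> y' < ?r n \<and>
      dir_deriv v (dir_deriv u f) (z + x *\<^sub>R u + y *\<^sub>R v) = dir_deriv u (dir_deriv v f) (z + x' *\<^sub>R v + y' *\<^sub>R u)" for n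
  proof -
    have r: "0 < ?r n" by simp
    obtain x y where xy: "0 < x" "x < ?r n" "0 < y" "y < ?r n"
      "f (z + ?r n *\<^sub>R u + ?r n *\<^sub>R v) - f (z + ?r n *\<^sub>R u) - (f (z + ?r n *\<^sub>R v) - f z)
         = ?r n * (?r n * dir_deriv v (dir_deriv u f) (z + x *\<^sub>R u + y *\<^sub>R v))"
      using second_difference_mvt[OF f r] by metis
    obtain x' y' where xy': "0 < x'" "x' < ?r n" "0 < y'" "y' < ?r n"
      "f (z + ?r n *\<^sub>R v + ?r n *\<^sub>R u) - f (z + ?r n *\<^sub>R v) - (f (z + ?r n *\<^sub>R u) - f z)
         = ?r n * (?r n * dir_deriv u (dir_deriv v f) (z + x' *\<^sub>R v + y' *\<^sub>R u))"
      using second_difference_mvt[OF f r] by metis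
    \<comment> \<open>The second difference is symmetric in \<open>u\<close> and \<open>v\<close>;
      cancelling the square of the step leaves equal values at two nearby points.\<close>
    have "?r n * (?r n * dir_deriv v (dir_deriv u f) (z + x *\<^sub>R u + y *\<^sub>R v))
        = ?r n * (?r n * dir_deriv u (dir_deriv v f) (z + x' *\<^sub>R v + y' *\<^sub>R u))"
      unfolding xy(5)[symmetric] xy'(5)[symmetric] by (simp add: ac_simps)
    then have "dir_deriv v (dir_deriv u f) (z + x *\<^sub>R u + y *\<^sub>R v) = dir_deriv u (dir_deriv v f) (z + x' *\<^sub>R v + y' *\<^sub>R u)"
      using r by (metis mult_left_cancel less_irrefl)
    with xy(1-4) xy'(1-4) show ?thesis by blast
  qed
  obtain x y x' y' where b: "\<And>n. 0 < x n" "\<And>n. x n < ?r n" "\<And>n. 0 < y n" "\<And>n. y n < ?r n"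
      "\<And>n. 0 < x' n" "\<And>n. x' n < ?r n" "\<And>n. 0 < y' n" "\<And>n. y' n < ?r n"
    and eq: "\<And>n. dir_deriv v (dir_deriv u f) (z + x n *\<^sub>R u + y n *\<^sub>R v) = dir_deriv u (dir_deriv v f) (z + x' n *\<^sub>R v + y' n *\<^sub>R u)"
    using ex by metis
  have null: "q \<longlonglongrightarrow> 0" if "\<And>n. 0 < q n" "\<And>n. q n < ?r n" for q :: "nat \<Rightarrow> real"
    using LIMSEQ_inverse_real_of_nat
    by (rule tendsto_sandwich[rotated 2, OF tendsto_const]) (use that in \<open>auto intro!: always_eventually less_imp_le simp del: of_nat_Suc\<close>)
  \<comment> \<open>Second derivatives of a smooth function are continuous, so the nearby points may
    be moved into \<open>z\<close>.\<close>
  have lim: "(\<lambda>n. dir_deriv w (dir_deriv w' f) (z + q n *\<^sub>R c + q' n *\<^sub>R d)) \<longlonglongrightarrow> dir_deriv w (dir_deriv w' f) z"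
    if "q \<longlonglongrightarrow> 0" "q' \<longlonglongrightarrow> 0" for q q' :: "nat \<Rightarrow> real" and c d w w'
  proof (rule continuous_on_tendsto_compose[OF smooth_continuous[OF smooth_dir_deriv[OF smooth_dir_deriv[OF f]]]])
    have "(\<lambda>n. z + q n *\<^sub>R c + q' n *\<^sub>R d) \<longlonglongrightarrow> z + 0 *\<^sub>R c + 0 *\<^sub>R d"
      by (intro tendsto_intros that)
    then show "(\<lambda>n. z + q n *\<^sub>R c + q' n *\<^sub>R d) \<longlonglongrightarrow> z" by simp
  qed auto
  have "(\<lambda>n. dir_deriv v (dir_deriv u f) (z + x n *\<^sub>R u + y n *\<^sub>R v)) \<longlonglongrightarrow> dir_deriv v (dir_deriv u f) z"
    by (intro lim null b)
  moreover have "(\<lambda>n. dir_deriv u (dir_deriv v f) (z + x' n *\<^sub>R v + y' n *\<^sub>R u)) \<longlonglongrightarrow> dir_deriv u (dir_deriv v f) z"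
    by (intro lim null b)
  ultimately show ?thesis unfolding eq by (rule LIMSEQ_unique[symmetric])
qed

text \<open>The derivative at a point is linear in the direction, so vanishing on
  \<open>Basis\<close> makes it vanish altogether.\<close>

lemma const_if_dir_deriv_zero:
  fixes f :: "'a::euclidean_space \<Rightarrow> real"
  assumes "smooth f" "\<And>v z. v \<in> Basis \<Longrightarrow> dir_deriv v f z = 0"
  shows "f z = f 0"
proof (rule has_derivative_zero_unique[of UNIV f])
  fix x :: 'a
  have lin: "linear (\<lambda>v. dir_deriv v f x)"
    using linear_frechet_derivative[OF smooth_differentiable[OF assms(1), of x]] by (simp add: dir_deriv_def)
  have "(\<lambda>v. dir_deriv v f x) = (\<lambda>v. 0)"
    by (rule linear_eq_stdbasis[OF lin]) (auto simp: assms(2) linear_zero)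
  then show "(f has_derivative (\<lambda>h. 0)) (at x)"
    using has_derivative_dir_deriv[OF smooth_differentiable[OF assms(1), of x]] by simp
qed auto

section \<open>Lie algebras of affine vector fields\<close>

declare transpose_matrix_vector [simp del]

lemma frechet_derivative_affine:
  fixes L :: "'a::euclidean_space \<Rightarrow> 'b::real_normed_vector"
  shows "linear L \<Longrightarrow> frechet_derivative (\<lambda>z. L z + w) (at z) = L"
  by (rule frechet_derivative_at[symmetric]) (rule has_derivative_affine)

text \<open>An ambient Lie algebra for all the concrete fields. It contains them because their
  coefficients are affine, and it makes brackets a matter of linear algebra.\<close>

definition affine_fields :: "('a::real_vector \<Rightarrow> 'a) set" where
  "affine_fields = {\<lambda>z. L z + w | L w. linear L}"

text \<open>The derivative of an affine field is its linear part at every point. The linear parts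
  appear in reversed order, the negative of the usual commutator; the minus sign in
  \<open>gl_field\<close> compensates for this.\<close>

lemma vf_bracket_affine:
  fixes L M :: "'a::euclidean_space \<Rightarrow> 'a"
  assumes "linear L" "linear M"
  shows "vf_bracket (\<lambda>z. L z + v) (\<lambda>z. M z + w) = (\<lambda>z. (M (L z) - L (M z)) + (M v - L w))"
  by (rule ext) (simp add: vf_bracket_def frechet_derivative_affine assms linear_add[OF assms(1)]
    linear_add[OF assms(2)])

lemma linear_commutator:
  assumes "linear L" "linear M"
  shows "linear (\<lambda>z. M (L z) - L (M z))"
  by (rule linear_compose_sub[OF linear_compose[OF assms, unfolded o_def]
    linear_compose[OF assms(2,1), unfolded o_def]])

lemma lie_algebra_onI:
  assumes "subspace L"
    and "\<And>x y. x \<in> L \<Longrightarrow> y \<in> L \<Longrightarrow> br x y \<in> L"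
    and "\<And>x y z c. x \<in> L \<Longrightarrow> y \<in> L \<Longrightarrow> z \<in> L \<Longrightarrow>
      br (x + y) z = br x z + br y z \<and> br z (x + y) = br z x + br z y \<and>
      br (c *\<^sub>R x) z = c *\<^sub>R br x z \<and> br z (c *\<^sub>R x) = c *\<^sub>R br z x"
    and "\<And>x. x \<in> L \<Longrightarrow> br x x = 0"
    and "\<And>x y z. x \<in> L \<Longrightarrow> y \<in> L \<Longrightarrow> z \<in> L \<Longrightarrow>
      br x (br y z) + br y (br z x) + br z (br x y) = 0"
  shows "lie_algebra_on L br"
  unfolding lie_algebra_on_def
proof (intro conjI ballI allI)
  fix x y z c
  assume "x \<in> L" "y \<in> L" "z \<in> L"
  then show "br x (br y z) + br y (br z x) + br z (br x y) = 0" by (rule assms(5))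
  note rules = assms(3)[OF \<open>x \<in> L\<close> \<open>y \<in> L\<close> \<open>z \<in> L\<close>, of c]
  show "br (x + y) z = br x z + br y z" by (rule rules[THEN conjunct1])
  show "br z (x + y) = br z x + br z y" by (rule rules[THEN conjunct2, THEN conjunct1])
  show "br (c *\<^sub>R x) z = c *\<^sub>R br x z"
    by (rule rules[THEN conjunct2, THEN conjunct2, THEN conjunct1])
  show "br z (c *\<^sub>R x) = c *\<^sub>R br z x"
    by (rule rules[THEN conjunct2, THEN conjunct2, THEN conjunct2])
next
  show "br x x = 0" if "x \<in> L" for x by (rule assms(4)[OF that])
  show "br x y \<in> L" if "x \<in> L" "y \<in> L" for x y by (rule assms(2)[OF that])
qed (rule assms(1))

lemma lie_algebra_onD:
  assumes "lie_algebra_on L br"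
  shows "subspace L"
    and "x \<in> L \<Longrightarrow> y \<in> L \<Longrightarrow> br x y \<in> L"
    and "x \<in> L \<Longrightarrow> y \<in> L \<Longrightarrow> z \<in> L \<Longrightarrow>
      br (x + y) z = br x z + br y z \<and> br z (x + y) = br z x + br z y \<and>
      br (c *\<^sub>R x) z = c *\<^sub>R br x z \<and> br z (c *\<^sub>R x) = c *\<^sub>R br z x"
    and "x \<in> L \<Longrightarrow> br x x = 0"
    and "x \<in> L \<Longrightarrow> y \<in> L \<Longrightarrow> z \<in> L \<Longrightarrow>
      br x (br y z) + br y (br z x) + br z (br x y) = 0"
proof -
  note parts = assms[unfolded lie_algebra_on_def]
  show "subspace L" by (rule parts[THEN conjunct1])
  show "br x y \<in> L" if "x \<in> L" "y \<in> L"
    by (rule parts[THEN conjunct2, THEN conjunct1, rule_format, OF that])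
  show "br (x + y) z = br x z + br y z \<and> br z (x + y) = br z x + br z y \<and>
      br (c *\<^sub>R x) z = c *\<^sub>R br x z \<and> br z (c *\<^sub>R x) = c *\<^sub>R br z x"
    if "x \<in> L" "y \<in> L" "z \<in> L"
    by (rule parts[THEN conjunct2, THEN conjunct2, THEN conjunct1, THEN bspec, THEN bspec, THEN bspec,
      THEN spec, OF that])
  show "br x x = 0" if "x \<in> L"
    by (rule parts[THEN conjunct2, THEN conjunct2, THEN conjunct2, THEN conjunct1, rule_format, OF that])
  show "br x (br y z) + br y (br z x) + br z (br x y) = 0" if "x \<in> L" "y \<in> L" "z \<in> L"
    by (rule parts[THEN conjunct2, THEN conjunct2, THEN conjunct2, THEN conjunct2, rule_format, OF that])
qed

lemma lie_algebra_on_affine_fields: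
  "lie_algebra_on (affine_fields :: ('a::euclidean_space \<Rightarrow> 'a) set) vf_bracket"
proof -
  have affI: "(\<lambda>z. L z + w) \<in> affine_fields" if "linear L" for L :: "'a \<Rightarrow> 'a" and w
    unfolding affine_fields_def using that by (intro CollectI exI[of _ L] exI[of _ w] conjI refl)
  have affE: thesis if "X \<in> affine_fields" "\<And>L w. linear L \<Longrightarrow> X = (\<lambda>z. L z + w) \<Longrightarrow> thesis"
    for X :: "'a \<Rightarrow> 'a" and thesis
    using that(1) unfolding affine_fields_def by (elim CollectE exE conjE) (rule that(2))
  \<comment> \<open>Sums and multiples are regrouped as a linear part plus a constant, the shape to
    which \<open>vf_bracket_affine\<close> applies.\<close>
  have add: "(\<lambda>z. L z + v) + (\<lambda>z. M z + w) = (\<lambda>z. (L z + M z) + (v + w))"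
    for L M :: "'a \<Rightarrow> 'a" and v w
    by (rule ext) simp
  have scale: "c *\<^sub>R (\<lambda>z. L z + v) = (\<lambda>z. c *\<^sub>R L z + c *\<^sub>R v)" for L :: "'a \<Rightarrow> 'a" and v c
    by (rule ext) (simp add: scaleR_fun_def scaleR_add_right)
  have zero: "(0 :: 'a \<Rightarrow> 'a) = (\<lambda>z. 0 + 0)" by (rule ext) simp
  show ?thesis
  proof (rule lie_algebra_onI)
    show "subspace (affine_fields :: ('a \<Rightarrow> 'a) set)"
    proof (rule subspaceI)
      show "(0 :: 'a \<Rightarrow> 'a) \<in> affine_fields"
        unfolding zero by (rule affI) (rule linear_zero)
      show "X + Y \<in> affine_fields" if XY: "X \<in> affine_fields" "Y \<in> affine_fields" for X Y :: "'a \<Rightarrow> 'a"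
      proof -
        obtain L v where L: "linear L" and X: "X = (\<lambda>z. L z + v)" using XY(1) by (rule affE)
        obtain M w where M: "linear M" and Y: "Y = (\<lambda>z. M z + w)" using XY(2) by (rule affE)
        note lin = L M and eq = X Y
        show ?thesis unfolding eq add by (rule affI[OF linear_compose_add[OF lin]])
      qed
      show "c *\<^sub>R X \<in> affine_fields" if X: "X \<in> affine_fields" for c and X :: "'a \<Rightarrow> 'a"
      proof -
        obtain L v where lin: "linear L" and eq: "X = (\<lambda>z. L z + v)"
          using X by (rule affE)
        show ?thesis unfolding eq scale by (rule affI[OF linear_compose_scale_right[OF lin]])
      qed
    qed
    show "vf_bracket X Y \<in> affine_fields" if XY: "X \<in> affine_fields" "Y \<in> affine_fields" for X Y :: "'a \<Rightarrow> 'a"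
    proof -
      obtain L v where L: "linear L" and X: "X = (\<lambda>z. L z + v)" using XY(1) by (rule affE)
      obtain M w where M: "linear M" and Y: "Y = (\<lambda>z. M z + w)" using XY(2) by (rule affE)
      note lin = L M and eq = X Y
      show ?thesis unfolding eq vf_bracket_affine[OF lin] by (rule affI[OF linear_commutator[OF lin]])
    qed
    show "vf_bracket (X + Y) Z = vf_bracket X Z + vf_bracket Y Z \<and>
        vf_bracket Z (X + Y) = vf_bracket Z X + vf_bracket Z Y \<and>
        vf_bracket (c *\<^sub>R X) Z = c *\<^sub>R vf_bracket X Z \<and> vf_bracket Z (c *\<^sub>R X) = c *\<^sub>R vf_bracket Z X"
      if XYZ: "X \<in> affine_fields" "Y \<in> affine_fields" "Z \<in> affine_fields" for X Y Z :: "'a \<Rightarrow> 'a" and c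
    proof -
      obtain L u where L: "linear L" and X: "X = (\<lambda>z. L z + u)" using XYZ(1) by (rule affE)
      obtain M v where M: "linear M" and Y: "Y = (\<lambda>z. M z + v)" using XYZ(2) by (rule affE)
      obtain N w where N: "linear N" and Z: "Z = (\<lambda>z. N z + w)" using XYZ(3) by (rule affE)
      note lin = L M N and eq = X Y Z
      show ?thesis
        unfolding eq add scale
          vf_bracket_affine[OF lin(1,3)] vf_bracket_affine[OF lin(3,1)]
          vf_bracket_affine[OF lin(2,3)] vf_bracket_affine[OF lin(3,2)]
          vf_bracket_affine[OF linear_compose_add[OF lin(1,2)] lin(3)]
          vf_bracket_affine[OF lin(3) linear_compose_add[OF lin(1,2)]]
          vf_bracket_affine[OF linear_compose_scale_right[OF lin(1)] lin(3)]
          vf_bracket_affine[OF lin(3) linear_compose_scale_right[OF lin(1)]]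
        by (intro conjI ext) (simp_all add: lin[THEN linear_add] lin[THEN linear_cmul] scaleR_diff_right
            scaleR_add_right)
    qed
    show "vf_bracket X X = 0" if "X \<in> affine_fields" for X :: "'a \<Rightarrow> 'a"
      by (rule ext) (simp add: vf_bracket_def)
    show "vf_bracket X (vf_bracket Y Z) + vf_bracket Y (vf_bracket Z X) + vf_bracket Z (vf_bracket X Y) = 0"
      if XYZ: "X \<in> affine_fields" "Y \<in> affine_fields" "Z \<in> affine_fields" for X Y Z :: "'a \<Rightarrow> 'a"
    proof -
      obtain L u where L: "linear L" and X: "X = (\<lambda>z. L z + u)" using XYZ(1) by (rule affE)
      obtain M v where M: "linear M" and Y: "Y = (\<lambda>z. M z + v)" using XYZ(2) by (rule affE)
      obtain N w where N: "linear N" and Z: "Z = (\<lambda>z. N z + w)" using XYZ(3) by (rule affE)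
      note lin = L M N and eq = X Y Z
      show ?thesis
        unfolding eq
          vf_bracket_affine[OF lin(1,2)] vf_bracket_affine[OF lin(2,3)] vf_bracket_affine[OF lin(3,1)]
          vf_bracket_affine[OF lin(1) linear_commutator[OF lin(2,3)]]
          vf_bracket_affine[OF lin(2) linear_commutator[OF lin(3,1)]]
          vf_bracket_affine[OF lin(3) linear_commutator[OF lin(1,2)]]
        by (rule ext) (simp add: lin[THEN linear_add] lin[THEN linear_diff])
    qed
  qed
qed

text \<open>Injectivity pulls the Lie algebra laws back along \<open>f\<close>, so none is needed for \<open>br\<close>.\<close>

lemma lie_iso_range:
  assumes L: "lie_algebra_on L br'" and f: "linear f" "inj f" "range f \<subseteq> L"
    and hom: "\<And>x y. f (br x y) = br' (f x) (f y)"
  shows "lie_iso UNIV br (range f) br' f"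
proof -
  have mem: "f x \<in> L" for x using f(3) by auto
  have inj: "x = y" if "f x = f y" for x y using f(2) that by (auto dest: injD)
  note lin = linear_add[OF f(1)] linear_cmul[OF f(1)] linear_0[OF f(1)]
  note bilinear = lie_algebra_onD(3)[OF L mem mem mem]
    and alternating = lie_algebra_onD(4)[OF L mem]
    and jacobi = lie_algebra_onD(5)[OF L mem mem mem]
  have closed: "br' (f x) (f y) \<in> range f" for x y
    unfolding hom[symmetric] by simp
  have "lie_algebra_on UNIV br"
  proof (rule lie_algebra_onI)
    show "br (x + y) z = br x z + br y z \<and> br z (x + y) = br z x + br z y \<and>
      br (c *\<^sub>R x) z = c *\<^sub>R br x z \<and> br z (c *\<^sub>R x) = c *\<^sub>R br z x" for x y z c
      by (intro conjI inj) (simp_all add: hom lin bilinear)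
    show "br x x = 0" for x by (rule inj) (simp add: hom lin alternating)
    show "br x (br y z) + br y (br z x) + br z (br x y) = 0" for x y z
      by (rule inj) (simp add: hom lin jacobi)
  qed simp_all
  moreover have "lie_algebra_on (range f) br'"
  proof (rule lie_algebra_onI)
    show "subspace (range f)" by (rule linear_subspace_image[OF f(1) subspace_UNIV])
  qed (use closed bilinear alternating jacobi in \<open>auto\<close>)
  ultimately show ?thesis
    using f(2) by (simp add: lie_iso_def lie_hom_def bij_betw_def hom lin)
qed

section \<open>The classical algebras and their vector fields\<close>

lemma matrix_vector_mult_minus: "(M :: real^'n^'m) *v (- x) = - (M *v x)"
  by (metis diff_0 matrix_vector_mult_0_right matrix_vector_mult_diff_distrib)

lemma linear_gl_to_sp: "linear (gl_to_sp M)"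
  by (rule linearI)
    (auto simp: gl_to_sp_def matrix_vector_right_distrib matrix_vector_mult_scaleR split: prod.splits)

lemma linear_gl_to_sp_matrix: "linear gl_to_sp"
proof (rule linearI)
  fix M N :: "real^'n^'n" and c :: real
  have "transpose (M + N) = transpose M + transpose N" by (simp add: transpose_def vec_eq_iff)
  then show "gl_to_sp (M + N) = gl_to_sp M + gl_to_sp N"
    by (auto simp: gl_to_sp_def fun_eq_iff matrix_vector_mult_add_rdistrib)
  have "transpose (c *\<^sub>R M) = c *\<^sub>R transpose M" by (simp add: transpose_def vec_eq_iff)
  then show "gl_to_sp (c *\<^sub>R M) = c *\<^sub>R gl_to_sp M"
    by (auto simp: gl_to_sp_def fun_eq_iff scaleR_fun_def scaleR_matrix_vector_assoc[symmetric])
qed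

text \<open>On the second component \<open>M\<close> acts in the standard way, and this already
  determines the matrix.\<close>

lemma inj_gl_to_sp: "inj gl_to_sp"
proof (rule injI)
  fix M N :: "real^'n^'n"
  assume "gl_to_sp M = gl_to_sp N"
  then have "snd (gl_to_sp M (0, b)) = snd (gl_to_sp N (0, b))" for b by simp
  then show "M = N" by (simp add: gl_to_sp_def matrix_eq)
qed

text \<open>The first component carries the dual representation: transposition reverses products,
  and the minus sign repairs this in the commutator.\<close>

lemma gl_to_sp_bracket: "gl_to_sp (gl_bracket M N) = end_bracket (gl_to_sp M) (gl_to_sp N)"
proof -
  have "transpose (M ** N - N ** M) = transpose N ** transpose M - transpose M ** transpose N"
    by (simp add: matrix_transpose_mul[symmetric]) (simp add: transpose_def vec_eq_iff)
  then show ?thesis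
    by (auto simp: gl_to_sp_def gl_bracket_def end_bracket_def fun_eq_iff matrix_vector_mult_diff_rdistrib
      matrix_vector_mul_assoc[symmetric] matrix_vector_mult_minus)
qed

lemma inner_transpose:
  fixes M :: "real^'n^'m"
  shows "(transpose M *v a) \<bullet> b = a \<bullet> (M *v b)" "b \<bullet> (transpose M *v a) = a \<bullet> (M *v b)"
  by (simp_all add: transpose_matrix_vector dot_lmul_matrix inner_commute[of b])

text \<open>The two components carry mutually dual actions, so the pairing terms of
  \<open>omega\<close> cancel in pairs.\<close>

lemma gl_to_sp_in_sp: "gl_to_sp M \<in> sp_algebra"
proof -
  have "omega (gl_to_sp M u) v + omega u (gl_to_sp M v) = 0" for u v
    by (cases u; cases v) (simp add: gl_to_sp_def omega_def inner_transpose inner_commute[of "M *v _"])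
  then show ?thesis unfolding sp_algebra_def using linear_gl_to_sp by blast
qed

lemma omega_bilinear:
  "omega (u + v) w = omega u w + omega v w" "omega w (u + v) = omega w u + omega w v"
  "omega (u - v) w = omega u w - omega v w" "omega w (u - v) = omega w u - omega w v"
  "omega (c *\<^sub>R u) w = c * omega u w" "omega w (c *\<^sub>R u) = c * omega w u"
  "omega 0 w = 0" "omega w 0 = 0"
  by (cases u; cases v; cases w;
    simp add: omega_def inner_simps zero_prod_def algebra_simps)+

lemma lie_algebra_on_sp: "lie_algebra_on (sp_algebra :: ((real^'n) \<times> (real^'n) \<Rightarrow> _) set) end_bracket"
proof -
  let ?S = "sp_algebra :: ((real^'n) \<times> (real^'n) \<Rightarrow> _) set"
  \<comment> \<open>The defining condition becomes a rewrite rule moving \<open>S\<close> across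
    \<open>omega\<close> at the cost of a sign; two such moves settle closure under
    \<open>end_bracket\<close>.\<close>
  have lin: "linear S" and om: "omega (S u) v = - omega u (S v)" if "S \<in> ?S" for S u v
    using that unfolding sp_algebra_def eq_neg_iff_add_eq_0 by blast+
  have memI: "S \<in> ?S" if "linear S" "\<And>u v. omega (S u) v + omega u (S v) = 0" for S
    using that unfolding sp_algebra_def by blast
  show ?thesis
  proof (rule lie_algebra_onI)
    show "subspace ?S"
    proof (rule subspaceI)
      show "0 \<in> ?S"
        by (rule memI) (auto simp: omega_bilinear intro: linearI)
      show "S + T \<in> ?S" if S: "S \<in> ?S" and T: "T \<in> ?S" for S T
        unfolding plus_fun_def
        by (rule memI[OF linear_compose_add[OF lin[OF S] lin[OF T]]])
          (simp add: omega_bilinear om[OF S] om[OF T])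
      show "c *\<^sub>R S \<in> ?S" if S: "S \<in> ?S" for c S
        unfolding scaleR_fun_def
        by (rule memI[OF linear_compose_scale_right[OF lin[OF S]]]) (simp add: omega_bilinear om[OF S])
    qed
    show "end_bracket S T \<in> ?S" if S: "S \<in> ?S" and T: "T \<in> ?S" for S T
    proof -
      have eq: "end_bracket S T = (\<lambda>z. S (T z) - T (S z))" by (auto simp: end_bracket_def)
      show ?thesis
        unfolding eq
        by (rule memI[OF linear_commutator[OF lin[OF T] lin[OF S]]])
          (simp add: omega_bilinear om[OF S] om[OF T])
    qed
    show "end_bracket (S + T) U = end_bracket S U + end_bracket T U \<and>
        end_bracket U (S + T) = end_bracket U S + end_bracket U T \<and>
        end_bracket (c *\<^sub>R S) U = c *\<^sub>R end_bracket S U \<and> end_bracket U (c *\<^sub>R S) = c *\<^sub>R end_bracket U S"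
      if "S \<in> ?S" "T \<in> ?S" and U: "U \<in> ?S" for S T U c
      by (intro conjI ext) (simp_all add: end_bracket_def scaleR_fun_def linear_add[OF lin[OF U]]
        linear_cmul[OF lin[OF U]] scaleR_diff_right)
    show "end_bracket S S = 0" if "S \<in> ?S" for S :: "(real^'n) \<times> (real^'n) \<Rightarrow> _"
      by (simp add: end_bracket_def)
    show "end_bracket S (end_bracket T U) + end_bracket T (end_bracket U S) + end_bracket U (end_bracket S T) = 0"
      if S: "S \<in> ?S" and T: "T \<in> ?S" and U: "U \<in> ?S" for S T U
      by (rule ext) (simp add: end_bracket_def linear_diff[OF lin[OF S]] linear_diff[OF lin[OF T]]
        linear_diff[OF lin[OF U]])
  qed
qed

section \<open>Parametrised vector fields and their brackets\<close>

definition gl_field :: "real^'n^'n \<Rightarrow> 'n phase \<Rightarrow> 'n phase" where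
  "gl_field M z = (0, - gl_to_sp M (snd z))"

text \<open>The coordinates are coefficients of \<open>field_A s i\<close> and
  \<open>field_B j\<close>, while the central one is scaled by \<open>- s\<close>, since the bracket
  of \<open>field_A s i\<close> with \<open>field_B i\<close> is
  \<open>(- s) *\<^sub>R field_xi\<close>.\<close>

definition heis_field :: "real \<Rightarrow> real \<times> (real^'n) \<times> (real^'n) \<Rightarrow> 'n phase \<Rightarrow> 'n phase" where
  "heis_field s = (\<lambda>(c, a, b) z. (- s * c - s * (a \<bullet> snd (snd z)), a, - b))"

text \<open>For \<open>s * s = 1\<close> this parametrises the whole Killing algebra, so that its
  structure can be read off from the parameters.\<close>

definition iso_field :: "real \<Rightarrow> (real^'n^'n) \<times> real \<times> (real^'n) \<times> (real^'n) \<Rightarrow> 'n phase \<Rightarrow> 'n phase" where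
  "iso_field s = (\<lambda>(M, h). gl_field M + heis_field s h)"

lemma iso_field_apply:
  "iso_field s (M, c, a, b) z =
    (- s * c - s * (a \<bullet> snd (snd z)), transpose M *v fst (snd z) + a, - (M *v snd (snd z)) - b)"
  by (simp add: iso_field_def gl_field_def heis_field_def gl_to_sp_def split: prod.splits)

text \<open>The linear part of \<open>iso_field\<close>, which is also its derivative at every
  point; \<open>c\<close> and \<open>b\<close> enter only the translation part.\<close>

definition iso_linear :: "real \<Rightarrow> real^'n^'n \<Rightarrow> real^'n \<Rightarrow> 'n phase \<Rightarrow> 'n phase" where
  "iso_linear s M a z = (- s * (a \<bullet> snd (snd z)), transpose M *v fst (snd z), - (M *v snd (snd z)))"

lemma linear_iso_linear: "linear (iso_linear s M a)"
  by (rule linearI) (simp_all add: iso_linear_def inner_add_right algebra_simps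
    matrix_vector_right_distrib matrix_vector_mult_scaleR)

lemma iso_field_eq: "iso_field s (M, c, a, b) = (\<lambda>z. iso_linear s M a z + (- s * c, a, - b))"
  by (rule ext) (simp add: iso_field_apply iso_linear_def)

lemma linear_gl_field: "linear gl_field"
  by (rule linearI) (auto simp: gl_field_def fun_eq_iff linear_add[OF linear_gl_to_sp_matrix]
    linear_cmul[OF linear_gl_to_sp_matrix] scaleR_fun_def)

lemma linear_heis_field: "linear (heis_field s)"
proof (rule linearI)
  fix x y :: "real \<times> (real^'n) \<times> (real^'n)" and r :: real
  show "heis_field s (x + y) = heis_field s x + heis_field s y"
    by (rule ext) (simp add: heis_field_def inner_add_left algebra_simps split: prod.splits)
  show "heis_field s (r *\<^sub>R x) = r *\<^sub>R heis_field s x"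
    by (rule ext) (simp add: heis_field_def scaleR_fun_def algebra_simps split: prod.splits)
qed

lemma linear_iso_field: "linear (iso_field s)"
  by (rule linearI) (simp_all only: iso_field_def split_beta fst_add snd_add fst_scaleR snd_scaleR
    linear_add[OF linear_gl_field] linear_add[OF linear_heis_field]
    linear_cmul[OF linear_gl_field] linear_cmul[OF linear_heis_field] scaleR_add_right ac_simps)

text \<open>Both sides are affine. The linear parts agree by matrix algebra, and
  \<open>omega\<close> arises from the translations: the \<open>x0\<close>-component of their
  contribution is \<open>- s\<close> times \<open>omega (a, b) (e, f)\<close>.\<close>

lemma iso_field_bracket:
  "iso_field s (semidirect_bracket gl_bracket heis_bracket (\<lambda>M. sp_on_heis (gl_to_sp M)) x y)
    = vf_bracket (iso_field s x) (iso_field s y)"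
proof -
  obtain M c a b where x: "x = (M, c, a, b)" by (rule prod_cases4)
  obtain N d e f where y: "y = (N, d, e, f)" by (rule prod_cases4)
  have tr: "transpose (M ** N - N ** M) = transpose N ** transpose M - transpose M ** transpose N"
    by (simp add: matrix_transpose_mul[symmetric]) (simp add: transpose_def vec_eq_iff)
  have "iso_field s (semidirect_bracket gl_bracket heis_bracket (\<lambda>M. sp_on_heis (gl_to_sp M)) x y) z
    = (iso_linear s N e (iso_linear s M a z) - iso_linear s M a (iso_linear s N e z))
      + (iso_linear s N e (- s * c, a, - b) - iso_linear s M a (- s * d, e, - f))" for z
    unfolding x y
    by (simp add: iso_linear_def iso_field_apply semidirect_bracket_def gl_bracket_def
      heis_bracket_def sp_on_heis_def omega_def gl_to_sp_def tr matrix_vector_mult_diff_rdistrib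
      matrix_vector_mul_assoc[symmetric] matrix_vector_mult_minus inner_simps inner_transpose inner_commute[of b e]
      matrix_vector_right_distrib matrix_vector_mult_diff_distrib right_diff_distrib distrib_left)
  then show ?thesis
    unfolding x y iso_field_eq[of s M] iso_field_eq[of s N] vf_bracket_affine[OF linear_iso_linear linear_iso_linear]
    by (rule ext)
qed

lemma inj_iso_field:
  assumes "s \<noteq> 0"
  shows "inj (iso_field s)"
  unfolding linear_injective_0[OF linear_iso_field]
proof (intro allI impI)
  fix x :: "(real^'n^'n) \<times> real \<times> (real^'n) \<times> (real^'n)"
  assume eq: "iso_field s x = 0"
  obtain M c a b where x: "x = (M, c, a, b)" by (rule prod_cases4)
  have z: "(- s * c - s * (a \<bullet> q), transpose M *v p + a, - (M *v q) - b) = 0" for p q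
    using fun_cong[OF eq, of "(0, p, q)"]
    by (simp add: x iso_field_apply)
  \<comment> \<open>The value at the origin is the translation part, and \<open>c\<close> occurs
    there with the nonzero factor \<open>- s\<close>.\<close>
  have "c = 0" "a = 0" "b = 0" using z[of 0 0] assms by (auto simp: zero_prod_def)
  moreover have "M *v q = 0" for q using z[where p = 0 and q = q] calculation by (simp add: zero_prod_def)
  then have "M = 0" by (simp add: matrix_eq)
  ultimately show "x = 0" by (simp add: x zero_prod_def)
qed

lemma iso_field_in_affine_fields: "iso_field s x \<in> affine_fields"
proof -
  obtain M c a b where x: "x = (M, c, a, b)" by (rule prod_cases4)
  show ?thesis unfolding x iso_field_eq affine_fields_def using linear_iso_linear by blast
qed

text \<open>The matrix unit has its entry in row \<open>l\<close> and column \<open>k\<close>: it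
  sends \<open>x\<close>-slot \<open>k\<close> to slot \<open>l\<close>, and its transpose sends
  \<open>p\<close>-slot \<open>l\<close> to slot \<open>k\<close>.\<close>

lemma gl_field_axis: "gl_field (axis l (axis k 1)) = field_Q k l"
proof
  fix z :: "'a phase"
  have entry: "axis l (axis k (1::real)) $ i $ j = (if i = l then (if j = k then 1 else 0) else 0)" for i j
    by (simp add: axis_def)
  have unit: "axis k (1::real) $ i = (if i = k then 1 else 0)" for k i :: 'a
    by (simp add: axis_def)
  have p: "(transpose (axis l (axis k 1)) *v fst (snd z)) $ i = (coord_p l z *\<^sub>R axis k 1) $ i" for i
    by (cases "i = k") (simp_all add: matrix_vector_mult_def transpose_def entry unit coord_p_def
      if_distrib[of "\<lambda>x. x * _"] cong: if_cong)
  have x: "(axis l (axis k 1) *v snd (snd z)) $ i = (coord_x k z *\<^sub>R axis l 1) $ i" for i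
    by (cases "i = l") (simp_all add: matrix_vector_mult_def entry unit coord_x_def
      if_distrib[of "\<lambda>x. x * _"] cong: if_cong)
  have "transpose (axis l (axis k 1)) *v fst (snd z) = coord_p l z *\<^sub>R axis k 1"
    "axis l (axis k 1) *v snd (snd z) = coord_x k z *\<^sub>R axis l 1"
    unfolding vec_eq_iff using p x by blast+
  then show "gl_field (axis l (axis k 1)) z = field_Q k l z"
    by (simp add: gl_field_def gl_to_sp_def field_Q_def d_p_def d_x_def split_beta)
qed

lemma heis_field_axes:
  "heis_field s (1, 0, 0) = (- s) *\<^sub>R field_xi"
  "heis_field s (0, axis i 1, 0) = field_A s i"
  "heis_field s (0, 0, axis j 1) = field_B j"
  by (rule ext, simp add: heis_field_def scaleR_fun_def field_xi_def field_A_def field_B_def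
    d_x0_def d_p_def d_x_def coord_x_def inner_axis')+

text \<open>A linear map takes the span of the matrix units onto the span of their images, and those
  are the generators.\<close>

lemma range_gl_field: "range gl_field = (gl_fields :: ('n::finite phase \<Rightarrow> _) set)"
proof -
  have B: "(Basis :: (real^'n^'n) set) = range (\<lambda>(k, l). axis l (axis k 1))"
    by (auto simp: Basis_vec_def)
  have "gl_field ` (Basis :: (real^'n^'n) set) = range (\<lambda>(k, l). field_Q k l)"
    unfolding B image_image split_beta gl_field_axis ..
  also have "\<dots> = {field_Q k l | k l. True}" by auto
  finally have img: "gl_field ` (Basis :: (real^'n^'n) set) = {field_Q k l | k l. True}" .
  have "range gl_field = gl_field ` span (Basis :: (real^'n^'n) set)" by simp
  also have "\<dots> = span (gl_field ` Basis)" by (rule linear_span_image[symmetric, OF linear_gl_field])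
  finally show ?thesis unfolding img gl_fields_def .
qed

lemma range_heis_field:
  assumes "s \<noteq> 0"
  shows "range (heis_field s) = (heis_fields s :: ('n::finite phase \<Rightarrow> _) set)"
proof -
  let ?B = "Basis :: (real \<times> (real^'n) \<times> (real^'n)) set"
  let ?AB = "range (field_A s) \<union> range field_B :: ('n phase \<Rightarrow> _) set"
  have B: "?B = {(1, 0, 0)} \<union> range (\<lambda>i. (0, axis i 1, 0)) \<union> range (\<lambda>j. (0, 0, axis j 1))"
    by (auto simp: Basis_prod_def Basis_vec_def zero_prod_def)
  have "heis_field s ` ?B = insert ((- s) *\<^sub>R field_xi) ?AB"
    unfolding B by (simp only: image_Un image_image image_insert image_empty heis_field_axes insert_is_Un[symmetric] Un_insert_left)
     (simp add: Un_assoc)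
  moreover have "range (heis_field s) = heis_field s ` span ?B" by simp
  moreover have "\<dots> = span (heis_field s ` ?B)" by (rule linear_span_image[symmetric, OF linear_heis_field])
  \<comment> \<open>The central basis vector goes to a nonzero multiple of \<open>field_xi\<close>;
    such a rescaling does not change the span, the factor \<open>- 1 / s\<close> undoing it.\<close>
  moreover have "span (insert ((- s) *\<^sub>R field_xi) ?AB) = span (insert field_xi ?AB)"
    unfolding span_eq
  proof
    have "(- s) *\<^sub>R field_xi \<in> span (insert field_xi ?AB)"
      by (intro span_scale span_base insertI1)
    then show "insert ((- s) *\<^sub>R field_xi) ?AB \<subseteq> span (insert field_xi ?AB)"
      using span_superset[of "insert field_xi ?AB"] by (simp only: insert_subset)
    have "(- 1 / s) *\<^sub>R (- s) *\<^sub>R field_xi \<in> span (insert ((- s) *\<^sub>R field_xi) ?AB)"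
      by (intro span_scale span_base insertI1)
    then have "field_xi \<in> span (insert ((- s) *\<^sub>R field_xi) ?AB)"
      using assms by simp
    then show "insert field_xi ?AB \<subseteq> span (insert ((- s) *\<^sub>R field_xi) ?AB)"
      using span_superset[of "insert ((- s) *\<^sub>R field_xi) ?AB"] by (simp only: insert_subset)
  qed
  ultimately show ?thesis by (simp add: heis_fields_def)
qed

section \<open>Killing equations\<close>

lemma theta_eq: "theta s z u = fst u + s * (fst (snd z) \<bullet> snd (snd u))"
  by (simp add: theta_def coord_x0_def coord_p_def coord_x_def inner_vec_def)

lemma mrugala_eq:
  "mrugala s z u v = fst (snd u) \<bullet> snd (snd v) + snd (snd u) \<bullet> fst (snd v) + theta s z u * theta s z v"
  by (simp add: mrugala_def sym_prod_def coord_p_def coord_x_def inner_vec_def sum_divide_distrib[symmetric]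
    sum.distrib)

lemma has_derivative_theta: "((\<lambda>y. theta s y u) has_derivative (\<lambda>w. s * (fst (snd w) \<bullet> snd (snd u)))) (at z)"
  unfolding theta_eq by (auto intro!: derivative_eq_intros)

lemma lie_deriv_theta:
  "lie_deriv_form X (theta s) z u
    = s * (fst (snd (X z)) \<bullet> snd (snd u)) + theta s z (frechet_derivative X (at z) u)"
  by (simp add: lie_deriv_form_def frechet_derivative_at[OF has_derivative_theta, symmetric])

text \<open>Leibniz rule. The term with \<open>dp\<close> and \<open>dx\<close> has constant
  coefficients, so only the derivative of \<open>X\<close> enters there.\<close>

lemma lie_deriv_mrugala:
  fixes X :: "'n::finite phase \<Rightarrow> 'n phase"
  defines "D \<equiv> \<lambda>z. frechet_derivative X (at z)"
  shows "lie_deriv_tensor X (mrugala s) z u v =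
    lie_deriv_form X (theta s) z u * theta s z v + theta s z u * lie_deriv_form X (theta s) z v
    + (fst (snd (D z u)) \<bullet> snd (snd v) + snd (snd (D z u)) \<bullet> fst (snd v)
    + fst (snd u) \<bullet> snd (snd (D z v)) + snd (snd u) \<bullet> fst (snd (D z v)))"
proof -
  have "((\<lambda>y. mrugala s y u v) has_derivative (\<lambda>w. theta s z u * (s * (fst (snd w) \<bullet> snd (snd v)))
      + s * (fst (snd w) \<bullet> snd (snd u)) * theta s z v)) (at z)"
    unfolding mrugala_eq by (auto intro!: derivative_eq_intros has_derivative_theta)
  then show ?thesis
    unfolding lie_deriv_tensor_def lie_deriv_theta
    by (simp add: frechet_derivative_at[symmetric] mrugala_eq D_def algebra_simps)
qed

lemma frechet_derivative_iso_field: "frechet_derivative (iso_field s (M, c, a, b)) (at z) = iso_linear s M a"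
  unfolding iso_field_eq by (rule frechet_derivative_affine) (rule linear_iso_linear)

text \<open>These fields preserve \<open>theta s\<close> exactly, not only up to a factor: the
  \<open>x0\<close>-component cancels the contribution of \<open>a\<close>, and moving the transpose
  across the inner product cancels that of \<open>M\<close>.\<close>

lemma lie_deriv_theta_iso_field: "lie_deriv_form (iso_field s x) (theta s) z u = 0"
proof -
  obtain M c a b where x: "x = (M, c, a, b)" by (rule prod_cases4)
  show ?thesis
    by (simp add: x lie_deriv_theta frechet_derivative_iso_field theta_eq iso_linear_def iso_field_apply
      inner_simps inner_transpose right_diff_distrib distrib_left)
qed

lemma smooth_iso_field: "smooth (iso_field s x)"
proof -
  obtain M c a b where x: "x = (M, c, a, b)" by (rule prod_cases4)
  show ?thesis unfolding x iso_field_eq by (rule smooth_affine) (rule linear_iso_linear)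
qed

lemma contact_iso_field: "contact_field (theta s) (iso_field s x)"
  unfolding contact_field_def
  by (intro conjI smooth_iso_field exI[of _ "\<lambda>_. 0"] smooth_const) (simp add: lie_deriv_theta_iso_field)

text \<open>As \<open>theta s\<close> is preserved, only the constant pairing of \<open>p\<close>
  with \<open>x\<close> remains, and \<open>transpose M\<close> and \<open>- M\<close> are dual with
  respect to it.\<close>

lemma killing_iso_field: "iso_field s x \<in> killing_algebra (mrugala s)"
proof -
  obtain M c a b where x: "x = (M, c, a, b)" by (rule prod_cases4)
  have "lie_deriv_tensor (iso_field s x) (mrugala s) z u v = 0" for z u v
    unfolding lie_deriv_mrugala lie_deriv_theta_iso_field
    by (simp add: x frechet_derivative_iso_field iso_linear_def inner_transpose inner_commute[of "M *v _"])
  then show ?thesis by (simp add: killing_algebra_def smooth_iso_field)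
qed

section \<open>Calculus rules for scalar functions and phase coordinates\<close>

lemma dir_deriv_cmult: "smooth f \<Longrightarrow> dir_deriv v (\<lambda>z. c * f z) = (\<lambda>z. c * dir_deriv v f z)"
  for f :: "'a::real_normed_vector \<Rightarrow> real"
  by (rule ext) (rule dir_deriv_bounded_linear_comp[OF bounded_linear_mult_right smooth_differentiable])

lemma dir_deriv_plus: "smooth f \<Longrightarrow> smooth g \<Longrightarrow> dir_deriv v (\<lambda>z. f z + g z) = (\<lambda>z. dir_deriv v f z + dir_deriv v g z)"
  by (rule ext) (rule dir_deriv_add[OF smooth_differentiable smooth_differentiable])

lemma smooth_cmult: "smooth f \<Longrightarrow> smooth (\<lambda>z. c * f z)"
  for f :: "'a::real_normed_vector \<Rightarrow> real"
  by (rule smooth_bounded_linear_comp[OF bounded_linear_mult_right])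

lemma smooth_mult: "smooth f \<Longrightarrow> smooth g \<Longrightarrow> smooth (\<lambda>z. f z * g z)"
  for f g :: "'a::real_normed_vector \<Rightarrow> real"
  using smooth_inner[of f g] by simp

lemma dir_deriv_mult: "smooth f \<Longrightarrow> smooth g \<Longrightarrow> dir_deriv v (\<lambda>z. f z * g z) = (\<lambda>z. f z * dir_deriv v g z + dir_deriv v f z * g z)"
  for f g :: "'a::real_normed_vector \<Rightarrow> real"
  by (rule ext) (use dir_deriv_inner[OF smooth_differentiable smooth_differentiable, of f g] in simp)

lemma smooth_linear: "linear L \<Longrightarrow> smooth L"
  for L :: "'a::euclidean_space \<Rightarrow> 'b::real_normed_vector"
  using smooth_affine[of L 0] by simp

lemma linear_coord_p: "linear (coord_p i)" and linear_coord_x: "linear (coord_x i)"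
  by (rule linearI; simp add: coord_p_def coord_x_def)+

lemmas bounded_linear_coord_p = linear_coord_p[unfolded linear_conv_bounded_linear]
lemmas bounded_linear_coord_x = linear_coord_x[unfolded linear_conv_bounded_linear]

lemmas smooth_ident = smooth_linear[OF linear_id, unfolded id_def]
lemmas smooth_fst = smooth_bounded_linear_comp[OF bounded_linear_fst]
lemmas smooth_snd = smooth_bounded_linear_comp[OF bounded_linear_snd]

lemma dir_deriv_linear: "linear L \<Longrightarrow> dir_deriv v L = (\<lambda>_. L v)"
  for L :: "'a::euclidean_space \<Rightarrow> 'b::real_normed_vector"
  by (rule ext) (rule dir_deriv_eqI[OF linear_imp_has_derivative])

lemma dir_deriv_coord:
  "dir_deriv v (coord_p i) = (\<lambda>_. coord_p i v)" "dir_deriv v (coord_x i) = (\<lambda>_. coord_x i v)"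
  by (simp_all add: dir_deriv_linear linear_coord_p linear_coord_x)

lemma coord_basis:
  "coord_p i d_x0 = 0" "coord_p i (d_p j) = (if i = j then 1 else 0)" "coord_p i (d_x j) = 0"
  "coord_x i d_x0 = 0" "coord_x i (d_x j) = (if i = j then 1 else 0)" "coord_x i (d_p j) = 0"
  by (simp_all add: coord_p_def coord_x_def d_x0_def d_p_def d_x_def axis_def)

lemma phase_const_if_dir_deriv_zero:
  fixes f :: "'n::finite phase \<Rightarrow> real"
  assumes "smooth f" "\<And>z. dir_deriv d_x0 f z = 0" "\<And>i z. dir_deriv (d_p i) f z = 0" "\<And>i z. dir_deriv (d_x i) f z = 0"
  shows "f z = f 0"
proof (rule const_if_dir_deriv_zero[OF assms(1)])
  fix v z :: "'n phase"
  assume "v \<in> Basis"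
  then have "v = d_x0 \<or> (\<exists>i. v = d_p i) \<or> (\<exists>i. v = d_x i)"
    by (auto simp: Basis_prod_def Basis_vec_def d_x0_def d_p_def d_x_def zero_prod_def)
  then show "dir_deriv v f z = 0" using assms(2-4) by metis
qed

text \<open>The Killing condition is evaluated on all pairs of coordinate directions. The
  \<open>x0\<close>-component of \<open>X\<close> is traded for \<open>h\<close>, which turns out to
  be constant along \<open>d_x0\<close>.\<close>

lemma killing_equations:
  fixes X :: "'n::finite phase \<Rightarrow> 'n phase"
  assumes X: "X \<in> killing_algebra (mrugala s)"
  defines "h \<equiv> contact_hamiltonian (theta s) X"
    and "a \<equiv> \<lambda>i z. coord_p i (X z)" and "b \<equiv> \<lambda>i z. coord_x i (X z)"
  shows "smooth h" "smooth (a i)" "smooth (b i)"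
    "dir_deriv d_x0 h z = 0"
    "dir_deriv d_x0 (b i) z + dir_deriv (d_p i) h z = s * b i z"
    "dir_deriv d_x0 (a i) z + dir_deriv (d_x i) h z = - s * a i z"
    "dir_deriv (d_p i) (b j) z + dir_deriv (d_p j) (b i) z = 0"
    "dir_deriv (d_x i) (a j) z + dir_deriv (d_x j) (a i) z
      = s * (coord_p j z * dir_deriv d_x0 (a i) z + coord_p i z * dir_deriv d_x0 (a j) z)"
    "dir_deriv (d_p i) (a j) z + dir_deriv (d_x j) (b i) z = s * (coord_p j z * dir_deriv d_x0 (b i) z)"
proof -
  have sm: "smooth X" and K: "lie_deriv_tensor X (mrugala s) z u v = 0" for z u v
    using X unfolding killing_algebra_def by blast+
  let ?D = "\<lambda>z. frechet_derivative X (at z)"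
  have D: "(X has_derivative ?D z) (at z)" for z
    using smooth_differentiable[OF sm] by (simp add: frechet_derivative_works)
  have h: "h = (\<lambda>z. fst (X z) + s * (fst (snd z) \<bullet> snd (snd (X z))))"
    by (rule ext) (simp add: h_def contact_hamiltonian_def theta_eq)
  show "smooth h"
    unfolding h by (intro smooth_add smooth_cmult smooth_inner smooth_fst smooth_snd smooth_ident sm)
  show "smooth (a i)" "smooth (b i)" for i
    unfolding a_def b_def by (intro smooth_bounded_linear_comp[OF bounded_linear_coord_p]
      smooth_bounded_linear_comp[OF bounded_linear_coord_x] sm)+
  have a: "coord_p i (?D z u) = dir_deriv u (a i) z" and b: "coord_x i (?D z u) = dir_deriv u (b i) z" for i z u
    unfolding a_def b_def
    using dir_deriv_bounded_linear_comp[OF bounded_linear_coord_p smooth_differentiable[OF sm], of u i z]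
      dir_deriv_bounded_linear_comp[OF bounded_linear_coord_x smooth_differentiable[OF sm], of u i z]
    by (simp_all add: dir_deriv_def)
  have "(h has_derivative (\<lambda>u. fst (?D z u) + s * (fst (snd z) \<bullet> snd (snd (?D z u))
      + fst (snd u) \<bullet> snd (snd (X z))))) (at z)" for z
    unfolding h by (auto intro!: derivative_eq_intros D)
  \<comment> \<open>Cartan's formula: the Lie derivative of \<open>theta s\<close> is the
    differential of \<open>h\<close> plus the contraction of \<open>X\<close> with \<open>s\<close>
    times the sum of the \<open>dp\<close> wedge \<open>dx\<close>.\<close>
  from dir_deriv_eqI[OF this]
  have L: "lie_deriv_form X (theta s) z u
      = s * (fst (snd (X z)) \<bullet> snd (snd u)) + dir_deriv u h z - s * (fst (snd u) \<bullet> snd (snd (X z)))" for z u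
    by (simp add: lie_deriv_theta theta_eq algebra_simps)
  have Lb: "lie_deriv_form X (theta s) z d_x0 = dir_deriv d_x0 h z"
    "lie_deriv_form X (theta s) z (d_p i) = dir_deriv (d_p i) h z - s * b i z"
    "lie_deriv_form X (theta s) z (d_x i) = dir_deriv (d_x i) h z + s * a i z" for i z
    by (simp_all add: L d_x0_def d_p_def d_x_def inner_axis inner_axis' a_def b_def coord_p_def coord_x_def)
  have theta: "theta s z d_x0 = 1" "theta s z (d_p i) = 0" "theta s z (d_x i) = s * coord_p i z" for i z
    by (simp_all add: theta_eq d_x0_def d_p_def d_x_def inner_axis coord_p_def)
  note K' = K[unfolded lie_deriv_mrugala]
  have proj: "fst (snd w) \<bullet> snd (snd (d_x i)) = coord_p i w" "snd (snd w) \<bullet> fst (snd (d_p i)) = coord_x i w"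
    "fst (snd (d_p i)) \<bullet> snd (snd w) = coord_x i w" "snd (snd (d_x i)) \<bullet> fst (snd w) = coord_p i w"
    "fst (snd d_x0) = 0" "snd (snd d_x0) = 0" "snd (snd (d_p i)) = 0" "fst (snd (d_x i)) = 0" for w :: "'n phase" and i
    by (simp_all add: d_x0_def d_p_def d_x_def inner_axis inner_axis' coord_p_def coord_x_def)
  \<comment> \<open>Since \<open>theta s z d_x0 = 1\<close>, the pairs containing
    \<open>d_x0\<close> determine the Lie derivative of \<open>theta s\<close>. These values are
    then inserted into the other pairs.\<close>
  have T: "dir_deriv d_x0 h z = 0" for z
    using K'[of z d_x0 d_x0] by (simp add: Lb theta proj)
  have P: "dir_deriv (d_p i) h z - s * b i z = - dir_deriv d_x0 (b i) z" for i z
    using K'[of z d_x0 "d_p i"] by (simp add: Lb theta proj T a b)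
  have Q: "dir_deriv (d_x i) h z + s * a i z = - dir_deriv d_x0 (a i) z" for i z
    using K'[of z d_x0 "d_x i"] by (simp add: Lb theta proj T a b)
  have Lp: "lie_deriv_form X (theta s) z (d_p i) = - dir_deriv d_x0 (b i) z" for i z
    unfolding Lb by (rule P)
  have Lx: "lie_deriv_form X (theta s) z (d_x i) = - dir_deriv d_x0 (a i) z" for i z
    unfolding Lb by (rule Q)
  show "dir_deriv d_x0 h z = 0" by (rule T)
  show "dir_deriv d_x0 (b i) z + dir_deriv (d_p i) h z = s * b i z" using P[of i z] by simp
  show "dir_deriv d_x0 (a i) z + dir_deriv (d_x i) h z = - s * a i z" using Q[of i z] by simp
  show "dir_deriv (d_p i) (b j) z + dir_deriv (d_p j) (b i) z = 0"
    using K'[of z "d_p i" "d_p j"] by (simp add: Lb theta proj a b)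
  show "dir_deriv (d_x i) (a j) z + dir_deriv (d_x j) (a i) z
      = s * (coord_p j z * dir_deriv d_x0 (a i) z + coord_p i z * dir_deriv d_x0 (a j) z)"
    using K'[of z "d_x i" "d_x j"] by (simp add: Lx theta proj a b) (simp add: algebra_simps)
  show "dir_deriv (d_p i) (a j) z + dir_deriv (d_x j) (b i) z = s * (coord_p j z * dir_deriv d_x0 (b i) z)"
    using K'[of z "d_p i" "d_x j"] by (simp add: Lp Lx theta proj a b)
qed

section \<open>Solving the Killing equations\<close>

lemma dir_deriv_commute_fun: "smooth f \<Longrightarrow> dir_deriv u (dir_deriv v f) = dir_deriv v (dir_deriv u f)"
  for f :: "'a::real_normed_vector \<Rightarrow> real"
  by (rule ext) (rule dir_deriv_commute)

lemma smooth_uminus: "smooth f \<Longrightarrow> smooth (\<lambda>z. - f z)"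
  by (rule smooth_bounded_linear_comp[OF bounded_linear_minus[OF bounded_linear_ident]])

lemma dir_deriv_uminus: "smooth f \<Longrightarrow> dir_deriv v (\<lambda>z. - f z) = (\<lambda>z. - dir_deriv v f z)"
  by (rule ext) (rule dir_deriv_bounded_linear_comp[OF bounded_linear_minus[OF bounded_linear_ident] smooth_differentiable])

lemma smooth_diff: "smooth f \<Longrightarrow> smooth g \<Longrightarrow> smooth (\<lambda>z. f z - g z)"
  using smooth_add[OF _ smooth_uminus] by simp

lemma dir_deriv_diff: "smooth f \<Longrightarrow> smooth g \<Longrightarrow> dir_deriv v (\<lambda>z. f z - g z) = (\<lambda>z. dir_deriv v f z - dir_deriv v g z)"
  using dir_deriv_plus[of f "\<lambda>z. - g z"] by (simp add: dir_deriv_uminus smooth_uminus)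

text \<open>Along \<open>d_x0\<close> the functions \<open>a'\<close> and \<open>b'\<close> are
  eigenfunctions with the opposite eigenvalues \<open>- s\<close> and \<open>s\<close>. This
  separates the terms of the mixed equation, after which commuting partial derivatives forces both
  to vanish.\<close>

lemma killing_time_independent:
  fixes X :: "'n::finite phase \<Rightarrow> 'n phase"
  assumes s: "s * s = 1" and X: "X \<in> killing_algebra (mrugala s)"
  shows "dir_deriv d_x0 (\<lambda>z. coord_p i (X z)) z = 0" "dir_deriv d_x0 (\<lambda>z. coord_x i (X z)) z = 0"
proof -
  define h where "h = contact_hamiltonian (theta s) X"
  define a where "a = (\<lambda>z. coord_p i (X z))"
  define b where "b = (\<lambda>z. coord_x i (X z))"
  have a_app: "a z = coord_p i (X z)" and b_app: "b z = coord_x i (X z)" for z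
    by (simp_all add: a_def b_def)
  define a' where "a' = dir_deriv d_x0 a"
  define b' where "b' = dir_deriv d_x0 b"
  note eqs = killing_equations[OF X, folded h_def a_def b_def]
  \<comment> \<open>The diagonal equations, with both indices equal to \<open>i\<close>,
    suffice.\<close>
  note eqs_i = killing_equations(7)[OF X, of i i, folded h_def a_def b_def]
    killing_equations(8)[OF X, of i i, folded h_def a_def b_def]
    killing_equations(9)[OF X, of i i, folded h_def a_def b_def]
    killing_equations(2,3,5,6)[OF X, of i, folded h_def a_def b_def]
  have sm: "smooth h" "smooth a" "smooth b" using eqs(1) eqs_i(4,5) by auto
  then have sm': "smooth a'" "smooth b'" by (simp_all add: a'_def b'_def smooth_dir_deriv)
  have "dir_deriv d_x0 h = (\<lambda>_. 0)" using eqs(4) by auto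
  then have Th: "dir_deriv d_x0 (dir_deriv v h) z = 0" for v z
    unfolding dir_deriv_commute_fun[OF sm(1), of d_x0 v] by (simp add: dir_deriv_const)
  have comm: "dir_deriv d_x0 (dir_deriv v a) = dir_deriv v a'" "dir_deriv d_x0 (dir_deriv v b) = dir_deriv v b'" for v
    unfolding a'_def b'_def by (rule dir_deriv_commute_fun[OF sm(2)], rule dir_deriv_commute_fun[OF sm(3)])
  have ss: "s * (x * (s * y)) = x * y" for x y
    using s by (metis mult.assoc mult.commute mult.right_neutral)
  note calc = dir_deriv_plus dir_deriv_diff dir_deriv_uminus dir_deriv_cmult dir_deriv_mult
    smooth_add smooth_diff smooth_uminus smooth_cmult smooth_mult smooth_dir_deriv sm sm'
    smooth_linear[OF linear_coord_p] dir_deriv_coord coord_basis Th comm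
  have "b' = (\<lambda>z. s * b z - dir_deriv (d_p i) h z)"
    using eqs_i(6) by (auto simp: b'_def fun_eq_iff algebra_simps a_app b_app)
  from arg_cong[OF this, of "dir_deriv d_x0"] have Tb': "dir_deriv d_x0 b' = (\<lambda>z. s * b' z)"
    by (simp add: calc b'_def[symmetric])
  have "a' = (\<lambda>z. - (s * a z) - dir_deriv (d_x i) h z)"
    using eqs_i(7) by (auto simp: a'_def fun_eq_iff algebra_simps a_app b_app)
  from arg_cong[OF this, of "dir_deriv d_x0"] have Ta': "dir_deriv d_x0 a' = (\<lambda>z. - (s * a' z))"
    by (simp add: calc a'_def[symmetric])
  \<comment> \<open>One derivative along \<open>d_x0\<close> turns the mixed equation into one for
    \<open>a'\<close> and \<open>b'\<close>, with \<open>s * s = 1\<close> removing the sign. A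
    second derivative multiplies the \<open>a'\<close> term by \<open>- s\<close> and the others by
    \<open>s\<close>.\<close>
  have "(\<lambda>z. dir_deriv (d_p i) a z + dir_deriv (d_x i) b z) = (\<lambda>z. s * (coord_p i z * b' z))"
    using eqs_i(3) by (auto simp: b'_def)
  from arg_cong[OF this, of "dir_deriv d_x0"]
  have mixed: "(\<lambda>z. dir_deriv (d_p i) a' z + dir_deriv (d_x i) b' z) = (\<lambda>z. coord_p i z * b' z)"
    by (simp add: calc Tb' ss)
  have "dir_deriv d_x0 (dir_deriv (d_p i) a') = (\<lambda>z. - (s * dir_deriv (d_p i) a' z))"
    unfolding dir_deriv_commute_fun[OF sm'(1), of d_x0] Ta' by (simp add: calc)
  moreover have "dir_deriv d_x0 (dir_deriv (d_x i) b') = (\<lambda>z. s * dir_deriv (d_x i) b' z)"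
    unfolding dir_deriv_commute_fun[OF sm'(2), of d_x0] Tb' by (simp add: calc)
  ultimately have scaled: "(\<lambda>z. - (s * dir_deriv (d_p i) a' z) + s * dir_deriv (d_x i) b' z) = (\<lambda>z. coord_p i z * (s * b' z))"
    using arg_cong[OF mixed, of "dir_deriv d_x0"] by (simp add: calc Tb')
  have "s * (- dir_deriv (d_p i) a' z + dir_deriv (d_x i) b' z) = s * (coord_p i z * b' z)" for z
    using fun_cong[OF scaled, of z]
    by (simp add: distrib_left right_diff_distrib mult.left_commute[of "coord_p i _"])
  moreover have "s \<noteq> 0" using s by auto
  ultimately have "- dir_deriv (d_p i) a' z + dir_deriv (d_x i) b' z = coord_p i z * b' z" for z
    by (metis mult_left_cancel)
  \<comment> \<open>Half the sum and half the difference of the two equations.\<close>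
  with fun_cong[OF mixed] have Pa': "dir_deriv (d_p i) a' = (\<lambda>_. 0)"
    and Xb': "dir_deriv (d_x i) b' = (\<lambda>z. coord_p i z * b' z)"
    by (simp_all add: fun_eq_iff) (smt (verit))+
  have "dir_deriv (d_p i) b = (\<lambda>_. 0)" using eqs_i(1) by (auto simp: fun_eq_iff)
  from arg_cong[OF this, of "dir_deriv d_x0"] have Pb': "dir_deriv (d_p i) b' = (\<lambda>_. 0)"
    by (simp add: calc dir_deriv_const)
  \<comment> \<open>As \<open>b'\<close> does not vary along \<open>d_p i\<close>, the product rule
    leaves only the derivative of the factor \<open>coord_p i\<close>; in the other order the mixed
    derivative is zero.\<close>
  have "b' z = dir_deriv (d_p i) (dir_deriv (d_x i) b') z" for z
    unfolding Xb' by (simp add: calc Pb')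
  also have "dir_deriv (d_p i) (dir_deriv (d_x i) b') z = 0" for z
    unfolding dir_deriv_commute_fun[OF sm'(2), of "d_p i"] Pb' by (simp add: dir_deriv_const)
  finally show "dir_deriv d_x0 (\<lambda>z. coord_x i (X z)) z = 0" by (simp add: b'_def b_def)
  have "dir_deriv (d_x i) a = (\<lambda>z. s * (coord_p i z * a' z))"
    using eqs_i(2) by (auto simp: a'_def fun_eq_iff)
  from arg_cong[OF this, of "dir_deriv d_x0"]
  have Xa': "dir_deriv (d_x i) a' = (\<lambda>z. - (coord_p i z * a' z))"
    by (simp add: calc Ta' ss)
  \<comment> \<open>The same computation for \<open>a'\<close>, now with \<open>Pa'\<close> in place
    of \<open>Pb'\<close>.\<close>
  have "- a' z = dir_deriv (d_p i) (dir_deriv (d_x i) a') z" for z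
    unfolding Xa' by (simp add: calc Pa')
  also have "dir_deriv (d_p i) (dir_deriv (d_x i) a') z = 0" for z
    unfolding dir_deriv_commute_fun[OF sm'(1), of "d_p i"] Pa' by (simp add: dir_deriv_const)
  finally show "dir_deriv d_x0 (\<lambda>z. coord_p i (X z)) z = 0" by (simp add: a'_def a_def)
qed

text \<open>Without derivatives along \<open>d_x0\<close> in the \<open>p\<close>- and
  \<open>x\<close>-components, the mixed equations become Hamilton's equations for
  \<open>h\<close>.\<close>

lemma killing_hamiltonian:
  fixes X :: "'n::finite phase \<Rightarrow> 'n phase"
  assumes s: "s * s = 1" and X: "X \<in> killing_algebra (mrugala s)"
  defines "h \<equiv> contact_hamiltonian (theta s) X"
  shows "dir_deriv d_x0 h z = 0" "dir_deriv (d_p i) h z = s * coord_x i (X z)" "dir_deriv (d_x i) h z = - s * coord_p i (X z)"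
  using killing_equations(4-6)[OF X] killing_time_independent[OF s X] by (simp_all add: h_def)

lemma killing_field_is_iso_field:
  fixes X :: "'n::finite phase \<Rightarrow> 'n phase"
  assumes s: "s * s = 1" and X: "X \<in> killing_algebra (mrugala s)"
  obtains x where "X = iso_field s x"
proof -
  define h where "h = contact_hamiltonian (theta s) X"
  define a where "a i = (\<lambda>z. coord_p i (X z))" for i
  define b where "b i = (\<lambda>z. coord_x i (X z))" for i
  have s0: "s \<noteq> 0" using s by auto
  note eqs = killing_equations[OF X, folded h_def a_def b_def]
  note sm = eqs(1-3)
  have T: "dir_deriv d_x0 (a i) z = 0" "dir_deriv d_x0 (b i) z = 0" for i z
    using killing_time_independent[OF s X] by (simp_all add: a_def b_def)
  then have T_fun: "dir_deriv d_x0 (a i) = (\<lambda>_. 0)" "dir_deriv d_x0 (b i) = (\<lambda>_. 0)" for i by auto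
  have Ph: "dir_deriv (d_p i) h = (\<lambda>z. s * b i z)" and Xh: "dir_deriv (d_x i) h = (\<lambda>z. - (s * a i z))" for i
    using killing_hamiltonian[OF s X] by (auto simp: h_def a_def b_def)
  \<comment> \<open>Up to the factor \<open>s\<close> these are second derivatives of
    \<open>h\<close>, hence symmetric in \<open>i\<close> and \<open>j\<close>, whereas the Killing
    equation makes them antisymmetric. The same argument applies to \<open>a\<close> in the
    \<open>x\<close>-directions.\<close>
  have "dir_deriv (d_p i) (b j) z = dir_deriv (d_p j) (b i) z" for i j z
    using dir_deriv_commute[OF sm(1), of "d_p i" "d_p j" z] s0 by (simp add: Ph dir_deriv_cmult sm)
  then have "dir_deriv (d_p i) (b j) z = 0" for i j z
    using eqs(7)[of i j z] by (smt (verit))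
  then have Pb: "dir_deriv (d_p i) (b j) = (\<lambda>_. 0)" for i j by auto
  have "dir_deriv (d_x i) (a j) z = dir_deriv (d_x j) (a i) z" for i j z
    using dir_deriv_commute[OF sm(1), of "d_x i" "d_x j" z] s0
    by (simp add: Xh dir_deriv_cmult dir_deriv_uminus smooth_cmult sm)
  then have "dir_deriv (d_x i) (a j) z = 0" for i j z
    using eqs(8)[of i j z] T by (smt (verit) mult_eq_0_iff)
  then have Xa: "dir_deriv (d_x i) (a j) = (\<lambda>_. 0)" for i j by auto
  have PaXb: "dir_deriv (d_p i) (a j) z = - dir_deriv (d_x j) (b i) z" for i j z
    using eqs(9)[of i j z] T by simp
  \<comment> \<open>The derivatives in question will be constant, so they are read off at the
    origin. The row index is the direction, as \<open>iso_field\<close> lets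
    \<open>transpose M\<close> act on \<open>p\<close>.\<close>
  define M :: "real^'n^'n" where "M = (\<chi> i j. dir_deriv (d_p i) (a j) 0)"
  have Pa_const: "dir_deriv (d_p i) (a j) z = M $ i $ j" for i j z
  proof -
    have "dir_deriv (d_p i) (a j) z = dir_deriv (d_p i) (a j) 0"
    proof (rule phase_const_if_dir_deriv_zero)
      show "smooth (dir_deriv (d_p i) (a j))" by (rule smooth_dir_deriv) (rule sm)
      show "dir_deriv d_x0 (dir_deriv (d_p i) (a j)) y = 0" for y
        by (simp add: dir_deriv_commute[OF sm(2), of d_x0] T_fun dir_deriv_const)
      show "dir_deriv (d_x k) (dir_deriv (d_p i) (a j)) y = 0" for k y
        by (simp add: dir_deriv_commute[OF sm(2), of "d_x k"] Xa dir_deriv_const)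
      \<comment> \<open>Passing from \<open>a j\<close> to \<open>b i\<close> helps because
        \<open>b i\<close> does not vary in any \<open>p\<close>-direction.\<close>
      have "dir_deriv (d_p i) (a j) = (\<lambda>z. - dir_deriv (d_x j) (b i) z)" using PaXb by auto
      then show "dir_deriv (d_p k) (dir_deriv (d_p i) (a j)) y = 0" for k y
        by (simp add: dir_deriv_uminus smooth_dir_deriv sm dir_deriv_commute[OF sm(3), of "d_p k"] Pb dir_deriv_const)
    qed
    then show ?thesis by (simp add: M_def)
  qed
  then have Xb_const: "dir_deriv (d_x j) (b i) z = - M $ i $ j" for i j z
    using PaXb[of i j z] by simp
  define al where "al = fst (snd (X 0))"
  define be where "be = - snd (snd (X 0))"
  \<comment> \<open>A comparison field with the right \<open>p\<close>- and
    \<open>x\<close>-components, which do not depend on the central parameter; that parameter is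
    fixed at the end.\<close>
  let ?Y = "iso_field s (M, 0, al, be)"
  have Y: "?Y \<in> killing_algebra (mrugala s)" by (rule killing_iso_field)
  have lin: "linear (\<lambda>z :: 'n phase. (transpose M *v fst (snd z)) $ i)" "linear (\<lambda>z :: 'n phase. (M *v snd (snd z)) $ i)" for i
    by (rule linearI; simp add: matrix_vector_right_distrib matrix_vector_mult_scaleR)+
  have proj: "fst (snd d_x0) = 0" "snd (snd d_x0) = 0" "fst (snd (d_p k)) = axis k 1" "snd (snd (d_p k)) = 0"
    "fst (snd (d_x k)) = 0" "snd (snd (d_x k)) = axis k 1" for k :: 'n
    by (simp_all add: d_x0_def d_p_def d_x_def)
  have axes: "(transpose M *v axis k 1) $ i = M $ k $ i" "(M *v axis k 1) $ i = M $ i $ k" for i k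
    by (simp_all add: matrix_vector_mul_component inner_axis transpose_def)
  have a_affine: "a i z - (transpose M *v fst (snd z)) $ i = a i 0 - (transpose M *v fst (snd (0 :: 'n phase))) $ i" for i z
    by (rule phase_const_if_dir_deriv_zero)
      (simp_all add: dir_deriv_diff dir_deriv_linear smooth_linear lin sm smooth_diff T Xa Pa_const
        proj axes)
  have aY: "coord_p i (X z) = coord_p i (?Y z)" for i z
    using a_affine[of i z]
    by (simp add: a_def al_def iso_field_apply coord_p_def algebra_simps)
  have b_affine: "b i z + (M *v snd (snd z)) $ i = b i 0 + (M *v snd (snd (0 :: 'n phase))) $ i" for i z
    by (rule phase_const_if_dir_deriv_zero)
      (simp_all add: dir_deriv_plus dir_deriv_linear smooth_linear lin sm smooth_add T Pb Xb_const
        proj axes)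
  have bY: "coord_x i (X z) = coord_x i (?Y z)" for i z
    using b_affine[of i z]
    by (simp add: b_def be_def iso_field_apply coord_x_def algebra_simps)
  define g where "g = contact_hamiltonian (theta s) ?Y"
  have smg: "smooth g" unfolding g_def by (rule killing_equations(1)[OF Y])
  note dh = killing_hamiltonian[OF s X, folded h_def] and dg = killing_hamiltonian[OF s Y, folded g_def]
  \<comment> \<open>By Hamilton's equations, equal \<open>p\<close>- and \<open>x\<close>-components
    give equal gradients.\<close>
  have hg: "h z - g z = h 0 - g 0" for z
    by (rule phase_const_if_dir_deriv_zero) (simp_all only: dir_deriv_diff sm(1) smg smooth_diff dh dg aY bY diff_self)
  have "fst (X z) - fst (?Y z) = h z - g z" for z
    by (simp only: h_def g_def contact_hamiltonian_def theta_def coord_x0_def aY bY add_diff_add diff_self add_0_right)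
  then have x0: "fst (X z) - fst (?Y z) = h 0 - g 0" for z
    using hg[of z] by (rule trans)
  have "snd (X z) = snd (?Y z)" for z
    using aY[of _ z] bY[of _ z] by (simp add: prod_eq_iff vec_eq_iff coord_p_def coord_x_def)
  \<comment> \<open>The central parameter enters with factor \<open>- s\<close>, so this choice
    shifts the \<open>x0\<close>-component by \<open>s * s * (h 0 - g 0)\<close>, which is the
    missing constant.\<close>
  then have "X z = iso_field s (M, - s * (h 0 - g 0), al, be) z" for z
    using s x0[of z] by (simp add: prod_eq_iff iso_field_apply mult.assoc[symmetric])
  then have "X = iso_field s (M, - s * (h 0 - g 0), al, be)" ..
  then show thesis by (rule that)
qed

lemma range_iso_field:
  assumes "s * s = 1"
  shows "range (iso_field s) = (killing_algebra (mrugala s) :: ('n::finite phase \<Rightarrow> _) set)"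
proof
  show "range (iso_field s) \<subseteq> (killing_algebra (mrugala s) :: ('n phase \<Rightarrow> _) set)"
    by (rule image_subsetI) (rule killing_iso_field)
  show "(killing_algebra (mrugala s) :: ('n phase \<Rightarrow> _) set) \<subseteq> range (iso_field s)"
  proof
    fix X :: "'n phase \<Rightarrow> 'n phase"
    assume "X \<in> killing_algebra (mrugala s)"
    then obtain x where "X = iso_field s x" by (rule killing_field_is_iso_field[OF assms])
    then show "X \<in> range (iso_field s)" by (rule range_eqI)
  qed
qed

section \<open>The isometry algebra\<close>

lemma semidirect_bracket_gl:
  "semidirect_bracket gl_bracket heis_bracket (\<lambda>M. sp_on_heis (gl_to_sp M)) (M, 0) (N, 0) = (gl_bracket M N, 0)"
  by (simp add: semidirect_bracket_def heis_bracket_def sp_on_heis_def zero_prod_def omega_def gl_to_sp_def)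

lemma semidirect_bracket_heis:
  fixes h h' :: "real \<times> (real^'n) \<times> (real^'n)"
  shows "semidirect_bracket gl_bracket heis_bracket (\<lambda>M. sp_on_heis (gl_to_sp M)) (0, h) (0, h') = (0, heis_bracket h h')"
proof -
  have "sp_on_heis (gl_to_sp 0) u = 0" for u :: "real \<times> (real^'n) \<times> (real^'n)"
    by (cases u) (simp add: sp_on_heis_def linear_0[OF linear_gl_to_sp_matrix] zero_prod_def)
  then show ?thesis by (simp add: semidirect_bracket_def gl_bracket_def)
qed

text \<open>The matrix part is a commutator with \<open>0\<close>. For the ideal property only this
  matters, so the Heisenberg part is left unspecified.\<close>

lemma semidirect_bracket_ideal:
  "\<exists>h''. semidirect_bracket gl_bracket heis_bracket (\<lambda>M. sp_on_heis (gl_to_sp M)) (M, h) (0, h') = (0, h'')"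
  by (simp add: semidirect_bracket_def gl_bracket_def del: split_paired_Ex)

lemma gl_field_eq_iso_field: "gl_field M = iso_field s (M, 0)"
  by (simp add: iso_field_def linear_0[OF linear_heis_field])

lemma heis_field_eq_iso_field: "heis_field s h = iso_field s (0, h)"
  by (simp add: iso_field_def linear_0[OF linear_gl_field])

lemma lie_iso_gl_field: "lie_iso UNIV gl_bracket gl_fields vf_bracket (gl_field :: real^'n^'n \<Rightarrow> _)"
  unfolding range_gl_field[symmetric]
proof (rule lie_iso_range[OF lie_algebra_on_affine_fields linear_gl_field])
  \<comment> \<open>\<open>gl_field\<close> is a restriction of \<open>iso_field s\<close> for every
    \<open>s\<close>; the nonzero value \<open>1\<close> is chosen to inherit injectivity.\<close>
  show "inj gl_field"
    by (rule injI) (simp add: gl_field_eq_iso_field[of _ 1] inj_eq[OF inj_iso_field])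
  show "range gl_field \<subseteq> affine_fields"
    unfolding gl_field_eq_iso_field[of _ 1] by (rule image_subsetI) (rule iso_field_in_affine_fields)
  show "gl_field (gl_bracket M N) = vf_bracket (gl_field M) (gl_field N)" for M N :: "real^'n^'n"
    unfolding gl_field_eq_iso_field[of _ 1] iso_field_bracket[symmetric] semidirect_bracket_gl ..
qed

lemma lie_iso_heis_field:
  assumes "s \<noteq> 0"
  shows "lie_iso UNIV heis_bracket (heis_fields s) vf_bracket (heis_field s)"
  unfolding range_heis_field[OF assms, symmetric]
proof (rule lie_iso_range[OF lie_algebra_on_affine_fields linear_heis_field])
  show "inj (heis_field s)"
    by (rule injI) (simp add: heis_field_eq_iso_field inj_eq[OF inj_iso_field[OF assms]] del: split_paired_All)
  show "range (heis_field s) \<subseteq> affine_fields"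
    unfolding heis_field_eq_iso_field by (rule image_subsetI) (rule iso_field_in_affine_fields)
  show "heis_field s (heis_bracket u v) = vf_bracket (heis_field s u) (heis_field s v)" for u v
    unfolding heis_field_eq_iso_field iso_field_bracket[symmetric] semidirect_bracket_heis ..
qed

lemma lie_iso_iso_field:
  assumes "s * s = 1"
  shows "lie_iso UNIV (semidirect_bracket gl_bracket heis_bracket (\<lambda>M. sp_on_heis (gl_to_sp M)))
    (killing_algebra (mrugala s)) vf_bracket (iso_field s)"
  unfolding range_iso_field[OF assms, symmetric]
proof (rule lie_iso_range[OF lie_algebra_on_affine_fields linear_iso_field])
  show "inj (iso_field s)" using assms by (intro inj_iso_field) auto
  show "range (iso_field s) \<subseteq> affine_fields"
    by (rule image_subsetI) (rule iso_field_in_affine_fields)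
  show "iso_field s (semidirect_bracket gl_bracket heis_bracket (\<lambda>M. sp_on_heis (gl_to_sp M)) x y)
      = vf_bracket (iso_field s x) (iso_field s y)" for x y
    by (rule iso_field_bracket)
qed

text \<open>Everything is transported to parameters by \<open>iso_field\<close>: the bracket there
  gives the ideal, injectivity the trivial intersection, and the definition of
  \<open>iso_field\<close> the sum.\<close>

lemma internal_semidirect_killing:
  assumes s: "s * s = 1"
  shows "internal_semidirect (killing_algebra (mrugala s)) gl_fields
    (heis_fields s :: ('n::finite phase \<Rightarrow> 'n phase) set) vf_bracket"
proof -
  have s0: "s \<noteq> 0" using s by auto
  have "lie_algebra_on (killing_algebra (mrugala s) :: ('n phase \<Rightarrow> _) set) vf_bracket"
    using lie_iso_iso_field[OF s] unfolding lie_iso_def lie_hom_def by (elim conjE)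
  moreover have "lie_algebra_on (gl_fields :: ('n phase \<Rightarrow> _) set) vf_bracket"
    using lie_iso_gl_field unfolding lie_iso_def lie_hom_def by (elim conjE)
  moreover have "lie_ideal (heis_fields s) (killing_algebra (mrugala s) :: ('n phase \<Rightarrow> _) set) vf_bracket"
    unfolding lie_ideal_def
  proof (intro conjI ballI)
    show "heis_fields s \<subseteq> (killing_algebra (mrugala s) :: ('n phase \<Rightarrow> _) set)"
      unfolding range_heis_field[OF s0, symmetric] heis_field_eq_iso_field
      by (rule image_subsetI) (rule killing_iso_field)
    show "subspace (heis_fields s :: ('n phase \<Rightarrow> _) set)"
      unfolding heis_fields_def by (rule subspace_span)
    fix X Y :: "'n phase \<Rightarrow> 'n phase"
    assume "X \<in> killing_algebra (mrugala s)" and "Y \<in> heis_fields s"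
    then obtain x h' where X: "X = iso_field s x" and Y: "Y = iso_field s (0, h')"
      unfolding range_iso_field[OF s, symmetric] range_heis_field[OF s0, symmetric] heis_field_eq_iso_field
      by (elim rangeE)
    obtain M h where x: "x = (M, h)" by (rule prod.exhaust)
    obtain h'' where "semidirect_bracket gl_bracket heis_bracket (\<lambda>M. sp_on_heis (gl_to_sp M)) (M, h) (0, h') = (0, h'')"
      using semidirect_bracket_ideal by (rule exE)
    then have "vf_bracket X Y = heis_field s h''"
      unfolding X Y x iso_field_bracket[symmetric] heis_field_eq_iso_field by (rule arg_cong)
    then show "vf_bracket X Y \<in> heis_fields s"
      unfolding range_heis_field[OF s0, symmetric] by (rule range_eqI)
  qed
  moreover have "gl_fields \<inter> heis_fields s = {0 :: 'n phase \<Rightarrow> 'n phase}"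
  proof (intro equalityI subsetI)
    fix X :: "'n phase \<Rightarrow> 'n phase"
    assume "X \<in> gl_fields \<inter> heis_fields s"
    then obtain M h where "X = gl_field M" "X = heis_field s h"
      unfolding range_gl_field[symmetric] range_heis_field[OF s0, symmetric] by (elim IntE rangeE)
    then have X: "X = iso_field s (M, 0)" "X = iso_field s (0, h)"
      by (simp_all only: gl_field_eq_iso_field[of _ s] heis_field_eq_iso_field)
    then have "(M, 0) = (0, h)" using injD[OF inj_iso_field[OF s0]] by metis
    then show "X \<in> {0}" using X(2) by (simp add: zero_prod_def[symmetric] linear_0[OF linear_iso_field])
  next
    fix X :: "'n phase \<Rightarrow> 'n phase"
    assume "X \<in> {0}"
    then show "X \<in> gl_fields \<inter> heis_fields s"
      by (simp add: gl_fields_def heis_fields_def span_zero)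
  qed
  moreover have "killing_algebra (mrugala s) = {X + Y | X Y :: 'n phase \<Rightarrow> 'n phase. X \<in> gl_fields \<and> Y \<in> heis_fields s}"
    unfolding range_gl_field[symmetric] range_heis_field[OF s0, symmetric] range_iso_field[OF s, symmetric]
      iso_field_def
    by force
  ultimately show ?thesis unfolding internal_semidirect_def by (intro conjI)
qed

section \<open>Brackets, contact property and Hamiltonians of the generators\<close>

lemma linear_field_Q: "linear (field_Q k l)"
  by (rule linearI) (simp_all add: field_Q_def linear_add[OF linear_coord_p] linear_add[OF linear_coord_x]
    linear_cmul[OF linear_coord_p] linear_cmul[OF linear_coord_x] scaleR_add_left scaleR_diff_right)

lemma frechet_derivative_fields:
  "frechet_derivative (field_Q k l) (at z) = field_Q k l"
  "frechet_derivative (field_A s i) (at z) = (\<lambda>u. - (s * coord_x i u) *\<^sub>R d_x0)"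
  "frechet_derivative (field_B j) (at z) = (\<lambda>_. 0)"
  "frechet_derivative field_xi (at z) = (\<lambda>_. 0)"
proof -
  show "frechet_derivative (field_Q k l) (at z) = field_Q k l"
    by (rule frechet_derivative_at[symmetric]) (rule linear_imp_has_derivative[OF linear_field_Q])
  have "(coord_x i has_derivative coord_x i) (at z)"
    by (rule linear_imp_has_derivative[OF linear_coord_x])
  then have "(field_A s i has_derivative (\<lambda>u. - (s * coord_x i u) *\<^sub>R d_x0)) (at z)"
    unfolding field_A_def by (auto intro!: derivative_eq_intros)
  then show "frechet_derivative (field_A s i) (at z) = (\<lambda>u. - (s * coord_x i u) *\<^sub>R d_x0)"
    by (rule frechet_derivative_at[symmetric])
qed (simp_all add: field_B_def field_xi_def)

lemma field_brackets:
  "vf_bracket (field_A s i) (field_B j) = (if i = j then (- s) *\<^sub>R field_xi else 0)"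
  "vf_bracket (field_Q k l) (field_A s i) = (if i = l then - field_A s k else 0)"
  "vf_bracket (field_Q k l) (field_B j) = (if k = j then field_B l else 0)"
  "vf_bracket (field_Q k l) (field_Q r t) =
    (if k = t then field_Q r l else 0) - (if r = l then field_Q k t else 0)"
  "vf_bracket (field_A s i) (field_A s j) = 0"
  "vf_bracket (field_B i) (field_B j) = 0"
  "vf_bracket field_xi (field_A s i) = 0"
  "vf_bracket field_xi (field_B i) = 0"
  "vf_bracket field_xi (field_Q k l) = 0"
  unfolding vf_bracket_def frechet_derivative_fields
  by (rule ext, simp add: field_A_def field_B_def field_Q_def field_xi_def
    scaleR_fun_def linear_add[OF linear_coord_p] linear_add[OF linear_coord_x]
    linear_diff[OF linear_coord_p] linear_diff[OF linear_coord_x] linear_neg[OF linear_coord_p] linear_neg[OF linear_coord_x]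
    linear_cmul[OF linear_coord_p] linear_cmul[OF linear_coord_x] coord_basis)+

lemma field_Q_eq_iso_field: "field_Q k l = iso_field s (axis l (axis k 1), 0)"
  unfolding gl_field_axis[symmetric] by (rule gl_field_eq_iso_field)

lemma field_A_eq_iso_field: "field_A s i = iso_field s (0, 0, axis i 1, 0)"
  unfolding heis_field_axes(2)[symmetric] by (rule heis_field_eq_iso_field)

lemma field_B_eq_iso_field: "field_B j = iso_field s (0, 0, 0, axis j 1)"
  unfolding heis_field_axes(3)[of s, symmetric] by (rule heis_field_eq_iso_field)

text \<open>The central parameter is multiplied by \<open>- s\<close>, and \<open>- s\<close> is its
  own inverse.\<close>

lemma field_xi_eq_iso_field:
  assumes "s * s = 1"
  shows "field_xi = iso_field s (0, - s, 0, 0)"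
  unfolding heis_field_eq_iso_field[symmetric]
  by (rule ext) (simp add: assms field_xi_def d_x0_def heis_field_def)

lemma field_hamiltonians:
  "contact_hamiltonian (theta s) field_xi = (\<lambda>z. 1)"
  "contact_hamiltonian (theta s) (field_A s i) = (\<lambda>z. - s * coord_x i z)"
  "contact_hamiltonian (theta s) (field_B j) = (\<lambda>z. - s * coord_p j z)"
  "contact_hamiltonian (theta s) (field_Q k l) = (\<lambda>z. - s * (coord_x k z * coord_p l z))"
  by (rule ext, simp add: contact_hamiltonian_def theta_eq field_xi_def field_A_def field_B_def field_Q_def
    d_x0_def d_p_def d_x_def inner_axis coord_p_def coord_x_def)+

text \<open>Both signs are treated together. For \<open>s = -1\<close> every factor
  \<open>- s\<close> is \<open>1\<close>; for \<open>s = 1\<close> the sign in the bracket of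
  \<open>field_A\<close> with \<open>field_B\<close> is absorbed by \<psi> on the centre.\<close>

theorem proposition2:
  fixes s :: real
  assumes "s = 1 \<or> s = -1"
  shows
    "internal_semidirect (killing_algebra (mrugala s)) gl_fields
       (heis_fields s :: ('n::finite phase \<Rightarrow> 'n phase) set) vf_bracket \<and>
     (lie_hom UNIV gl_bracket sp_algebra end_bracket
         (gl_to_sp :: real^'n^'n \<Rightarrow> (real^'n) \<times> (real^'n) \<Rightarrow> (real^'n) \<times> (real^'n)) \<and>
       inj (gl_to_sp :: real^'n^'n \<Rightarrow> (real^'n) \<times> (real^'n) \<Rightarrow> (real^'n) \<times> (real^'n))) \<and>
     (\<exists>(\<phi> :: real^'n^'n \<Rightarrow> 'n phase \<Rightarrow> 'n phase) (\<psi> :: real \<times> (real^'n) \<times> (real^'n) \<Rightarrow> 'n phase \<Rightarrow> 'n phase).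
        lie_iso UNIV gl_bracket gl_fields vf_bracket \<phi> \<and>
        lie_iso UNIV heis_bracket (heis_fields s) vf_bracket \<psi> \<and>
        lie_iso UNIV (semidirect_bracket gl_bracket heis_bracket (\<lambda>M. sp_on_heis (gl_to_sp M)))
          (killing_algebra (mrugala s)) vf_bracket (\<lambda>(M, h). \<phi> M + \<psi> h) \<and>
        (\<forall>M z. \<phi> M z = (0, - gl_to_sp M (snd z))) \<and>
        (\<forall>k l. \<phi> (axis l (axis k 1)) = field_Q k l) \<and>
        \<psi> (1, 0, 0) = (- s) *\<^sub>R field_xi \<and>
        (\<forall>i. \<psi> (0, axis i 1, 0) = field_A s i) \<and>
        (\<forall>j. \<psi> (0, 0, axis j 1) = field_B j)) \<and>
     (\<forall>(i::'n) (j::'n). vf_bracket (field_A s i) (field_B j) = (if i = j then (- s) *\<^sub>R field_xi else 0)) \<and>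
     (\<forall>(k::'n) (l::'n) (i::'n). vf_bracket (field_Q k l) (field_A s i) = (if i = l then - field_A s k else 0)) \<and>
     (\<forall>(k::'n) (l::'n) (j::'n). vf_bracket (field_Q k l) (field_B j) = (if k = j then field_B l else 0)) \<and>
     (\<forall>(k::'n) (l::'n) (r::'n) (t::'n). vf_bracket (field_Q k l) (field_Q r t) =
        (if k = t then field_Q r l else 0) - (if r = l then field_Q k t else 0)) \<and>
     (\<forall>(i::'n) (j::'n). vf_bracket (field_A s i) (field_A s j) = 0 \<and> vf_bracket (field_B i) (field_B j) = 0) \<and>
     (\<forall>(i::'n) (k::'n) (l::'n). vf_bracket field_xi (field_A s i) = 0 \<and> vf_bracket field_xi (field_B i) = 0 \<and> vf_bracket field_xi (field_Q k l) = 0) \<and>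
     contact_field (theta s) (field_xi :: 'n phase \<Rightarrow> 'n phase) \<and>
     (\<forall>(i::'n) (j::'n) (k::'n) (l::'n). contact_field (theta s) (field_A s i) \<and> contact_field (theta s) (field_B j) \<and>
        contact_field (theta s) (field_Q k l)) \<and>
     contact_hamiltonian (theta s) (field_xi :: 'n phase \<Rightarrow> 'n phase) = (\<lambda>z. 1) \<and>
     (\<forall>(i::'n). contact_hamiltonian (theta s) (field_A s i) = (\<lambda>z. - s * coord_x i z)) \<and>
     (\<forall>(j::'n). contact_hamiltonian (theta s) (field_B j) = (\<lambda>z. - s * coord_p j z)) \<and>
     (\<forall>(k::'n) (l::'n). contact_hamiltonian (theta s) (field_Q k l) = (\<lambda>z. - s * (coord_x k z * coord_p l z)))"
proof -
  have s: "s * s = 1" and s0: "s \<noteq> 0" using assms by auto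
  have iso: "(\<lambda>(M, h). gl_field M + heis_field s h) = iso_field s"
    by (simp only: iso_field_def)
  \<comment> \<open>That matrices form a Lie algebra is already contained in
    \<open>lie_iso_gl_field\<close>, having been pulled back along \<open>gl_field\<close>.\<close>
  have gl_sp: "lie_hom UNIV gl_bracket sp_algebra end_bracket
      (gl_to_sp :: real^'n^'n \<Rightarrow> (real^'n) \<times> (real^'n) \<Rightarrow> (real^'n) \<times> (real^'n))"
    using lie_iso_gl_field gl_to_sp_in_sp
    by (auto simp: lie_iso_def lie_hom_def lie_algebra_on_sp gl_to_sp_bracket
      linear_add[OF linear_gl_to_sp_matrix] linear_cmul[OF linear_gl_to_sp_matrix])
  \<comment> \<open>Each generator is a value of \<open>iso_field s\<close>, and all of these
    preserve \<open>theta s\<close>.\<close>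
  have contact: "contact_field (theta s) (field_xi :: 'n phase \<Rightarrow> 'n phase)"
    "contact_field (theta s) (field_A s i)" "contact_field (theta s) (field_B j)"
    "contact_field (theta s) (field_Q k l)" for i j k l :: 'n
    unfolding field_xi_eq_iso_field[OF s] field_A_eq_iso_field field_B_eq_iso_field[of _ s]
      field_Q_eq_iso_field[of _ _ s]
    by (rule contact_iso_field)+
  show ?thesis
    by (intro conjI allI exI[of _ gl_field] exI[of _ "heis_field s"] internal_semidirect_killing[OF s] gl_sp
        inj_gl_to_sp lie_iso_gl_field lie_iso_heis_field[OF s0] lie_iso_iso_field[OF s, folded iso]
        gl_field_def gl_field_axis heis_field_axes field_brackets field_hamiltonians contact)
qed

end
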